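(* Let $\Omega\subset\mathbb{R}^d$ be a bounded domain with smooth boundary. Let $f\in C_0^\infty(\Omega)$ satisfy $f\ge 0$ and $f\not\equiv 0$ on $\overline{\Omega}$, let $x_0\in\Omega$, let $a>0$, and let $\theta\in L^2_{loc}(\mathbb{R})$ be monotone decreasing (i.e. non-increasing) with $\theta(t)=1$ for $t\le 0$ and $\theta(t)=0$ for $t\ge a$. For $t_0>0$ let $u_{t_0}=u_{t_0}(x,t)$ denote the solution of $$\partial_t u=\Delta u+\theta(t-t_0)f(x)\ \ (x\in\Omega,\ t>0),\qquad u(x,0)=0\ \ (x\in\Omega),\qquad \partial_\nu u(x,t)=0\ \ (x\in\partial\Omega,\ t>0).$$ Fix constants $t_*,t^*,T^*>0$ with $t_*<t^*<T^*-a$. Then there exists a constant $C=C(t_*,t^*,a,x_0,T^* )>0$ such that for all $t_0,t_1\in(t_*,t^* )$, $$|t_1-t_0|\le C\,|u_{t_0}(x_0,T^* )-u_{t_1}(x_0,T^* )|.$$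
   Context: $\nu$ is the unit outward normal vector to $\partial\Omega$ and $\partial_\nu u=\nabla u\cdot\nu$. The data $\Omega,\theta,f$ are regarded as fixed; the constant $C$ may depend on them, but not on $t_0,t_1$. The solution $u_{t_0}$ is continuous on $\overline{\Omega}\times[0,T^*]$, so that point values $u_{t_0}(x_0,T^* )$ are well defined. *)

theory Defs
  imports "HOL-Analysis.Analysis"
begin

text \<open>The predicate is meant for open sets \<open>S\<close>: \<open>f\<close> has continuous partial derivatives up to order \<open>k\<close>.\<close>

primrec Ck_on :: "nat \<Rightarrow> 'a::euclidean_space set \<Rightarrow> ('a \<Rightarrow> real) \<Rightarrow> bool" where
  "Ck_on 0 S f = continuous_on S f"
| "Ck_on (Suc k) S f =
     ((\<forall>x\<in>S. f differentiable (at x)) \<and>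
      (\<forall>b\<in>Basis. Ck_on k S (\<lambda>x. frechet_derivative f (at x) b)))"

definition smooth_on :: "'a::euclidean_space set \<Rightarrow> ('a \<Rightarrow> real) \<Rightarrow> bool" where
  "smooth_on S f \<longleftrightarrow> (\<forall>k. Ck_on k S f)"

text \<open>Elements of \<open>C_0^\<infinity>(\<Omega>)\<close> are represented by their extension by zero to the whole space.\<close>

definition test_function :: "'a::euclidean_space set \<Rightarrow> ('a \<Rightarrow> real) \<Rightarrow> bool" where
  "test_function \<Omega> f \<longleftrightarrow>
     smooth_on UNIV f \<and> compact (closure {x. f x \<noteq> 0}) \<and> closure {x. f x \<noteq> 0} \<subseteq> \<Omega>"

definition locally_L2 :: "(real \<Rightarrow> real) \<Rightarrow> bool" where
  "locally_L2 \<theta> \<longleftrightarrow>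
     \<theta> \<in> borel_measurable lebesgue \<and>
     (\<forall>K. compact K \<longrightarrow> set_integrable lebesgue K (\<lambda>t. (\<theta> t)\<^sup>2))"

definition grad :: "('a::euclidean_space \<Rightarrow> real) \<Rightarrow> 'a \<Rightarrow> 'a" where
  "grad g x = (\<Sum>b\<in>Basis. frechet_derivative g (at x) b *\<^sub>R b)"

definition laplacian :: "('a::euclidean_space \<Rightarrow> real) \<Rightarrow> 'a \<Rightarrow> real" where
  "laplacian g x =
     (\<Sum>b\<in>Basis. frechet_derivative (\<lambda>y. frechet_derivative g (at y) b) (at x) b)"

text \<open>Near each boundary point, \<open>\<Omega>\<close> is the strict sublevel set of a smooth function without
  critical points; in particular \<open>\<Omega>\<close> lies locally on one side of its boundary.\<close>

definition local_defining_function ::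
  "'a::euclidean_space set \<Rightarrow> 'a \<Rightarrow> 'a set \<Rightarrow> ('a \<Rightarrow> real) \<Rightarrow> bool" where
  "local_defining_function \<Omega> p U \<rho> \<longleftrightarrow>
     open U \<and> p \<in> U \<and> smooth_on U \<rho> \<and> (\<forall>x\<in>U. grad \<rho> x \<noteq> 0) \<and>
     \<Omega> \<inter> U = {x \<in> U. \<rho> x < 0}"

definition smooth_boundary :: "'a::euclidean_space set \<Rightarrow> bool" where
  "smooth_boundary \<Omega> \<longleftrightarrow> (\<forall>p\<in>frontier \<Omega>. \<exists>U \<rho>. local_defining_function \<Omega> p U \<rho>)"

text \<open>The vector does not depend on the choice of \<open>U\<close> and \<open>\<rho>\<close>; \<open>sgn v\<close> is \<open>v\<close> divided by its norm.\<close>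

definition outward_normal :: "'a::euclidean_space set \<Rightarrow> 'a \<Rightarrow> 'a" where
  "outward_normal \<Omega> p =
     (SOME n. \<exists>U \<rho>. local_defining_function \<Omega> p U \<rho> \<and> n = sgn (grad \<rho> p))"

text \<open>\<open>g\<close> is continuously differentiable up to the boundary of \<open>\<Omega>\<close> with vanishing normal derivative.
  On \<open>frontier \<Omega>\<close> the gradient of \<open>g\<close> is the (unique) continuous extension \<open>G\<close> of the interior one.\<close>

definition neumann_condition :: "'a::euclidean_space set \<Rightarrow> ('a \<Rightarrow> real) \<Rightarrow> bool" where
  "neumann_condition \<Omega> g \<longleftrightarrow>
     (\<exists>G. continuous_on (closure \<Omega>) G \<and> (\<forall>x\<in>\<Omega>. G x = grad g x) \<and>
          (\<forall>p\<in>frontier \<Omega>. G p \<bullet> outward_normal \<Omega> p = 0))"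

text \<open>Solutions of the initial-boundary value problem with source \<open>\<theta>(t - t\<^sub>0) f(x)\<close>.
  Since \<open>\<theta>\<close> may jump, \<open>\<partial>\<^sub>t u\<close> need not exist at every time; a monotone \<open>\<theta>\<close> has at most countably many
  jumps, so the equation is required to hold for all \<open>t > 0\<close> outside a countable set \<open>N\<close>. Because \<open>u\<close>
  is continuous in \<open>t\<close>, this still determines \<open>u\<close>. (Continuity together with an equation holding
  merely almost everywhere would not: it allows adding singular functions of \<open>t\<close>.)\<close>

definition heat_solution ::
  "'a::euclidean_space set \<Rightarrow> (real \<Rightarrow> real) \<Rightarrow> ('a \<Rightarrow> real) \<Rightarrow> real \<Rightarrow> ('a \<Rightarrow> real \<Rightarrow> real) \<Rightarrow> bool"
  where
  "heat_solution \<Omega> \<theta> f t\<^sub>0 u \<longleftrightarrow>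
     continuous_on (closure \<Omega> \<times> {0..}) (\<lambda>(x, t). u x t) \<and>
     (\<forall>t>0. Ck_on 2 \<Omega> (\<lambda>x. u x t)) \<and>
     (\<exists>N. countable N \<and>
        (\<forall>t>0. t \<notin> N \<longrightarrow> (\<forall>x\<in>\<Omega>.
           ((\<lambda>s. u x s) has_real_derivative
              laplacian (\<lambda>y. u y t) x + \<theta> (t - t\<^sub>0) * f x) (at t)))) \<and>
     (\<forall>x\<in>\<Omega>. u x 0 = 0) \<and>
     (\<forall>t>0. neumann_condition \<Omega> (\<lambda>x. u x t))"

end

theory Submission
  imports Defs
begin

text \<open>For \<open>t0 < t1\<close> the difference \<open>w = v - u\<close> solves the heat equation with the nonnegative source
  \<open>(\<theta>(t - t1) - \<theta>(t - t0)) f(x)\<close>, whose time integral is \<open>t1 - t0\<close>. A minimum principle, with a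
  barrier decreasing in the inward normal direction, gives \<open>w \<ge> 0\<close>. Explicit subsolutions of the
  form \<open>A(t) ((\<rho>(t)\<^sup>2 - \<bar>x - p\<bar>\<^sup>2)\<^sup>+)\<^sup>2\<close> then show first that \<open>w\<close> is at least a multiple of \<open>t1 - t0\<close> on
  a small ball where \<open>f > 0\<close> once the source is switched off, and then that such a lower bound
  propagates along chains of balls to \<open>x0\<close> at time \<open>T\<close>. All constants are independent of \<open>t0\<close>,
  \<open>t1\<close> and of the solutions.\<close>

subsection \<open>Minimum principles\<close>

text \<open>The strong maximum principle alone would give \<open>w > 0\<close> without any rate, so
  each comparison is made quantitative and linear in the data. The rate comes from the time integral
  of the source, which does not depend on the profile of \<theta>. The Neumann condition enters only
  through \<open>w \<ge> 0\<close>. Once this is known, comparison becomes local: a barrier that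
  vanishes off a ball inside the domain requires nothing of \<open>w\<close> at the edge of the ball
  beyond its sign. The positive part is squared because the Laplacian of \<open>q\<^sup>2\<close> is
  close to \<open>8 \<bar>x - p\<bar>\<^sup>2\<close> where \<open>q\<close> is near 0, and this
  positive reserve absorbs the other terms there; the Laplacian of \<open>q\<close> itself is
  negative. The gap between \<open>t_up + a\<close> and \<open>T\<close> is the time available for
  propagation to \<open>x0\<close>. Since \<theta> may jump, time derivatives are available only off
  a countable set, so the arguments are pointwise, at minima, rather than by integration over the
  domain.\<close>

text \<open>The exceptional times form a countable set, so a first-crossing argument works after choosing
  a level that the spatial minimum does not attain at any exceptional time.\<close>

lemma parabolic_min_principle:
  fixes W :: "'b::metric_space \<Rightarrow> real \<Rightarrow> real"
  assumes "compact K" and cont: "continuous_on (K \<times> {s0..s1}) (\<lambda>(x, t). W x t)"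
    and "countable N" and init: "\<And>x. x \<in> K \<Longrightarrow> 0 \<le> W x s0"
    and no_min: "\<And>x t. x \<in> K \<Longrightarrow> s0 < t \<Longrightarrow> t \<le> s1 \<Longrightarrow> t \<notin> N \<Longrightarrow> W x t < 0 \<Longrightarrow>
      (\<And>y. y \<in> K \<Longrightarrow> W x t \<le> W y t) \<Longrightarrow> (\<And>s. s \<in> {s0..t} \<Longrightarrow> W x t \<le> W x s) \<Longrightarrow> False"
    and "x1 \<in> K" and "t1 \<in> {s0..s1}"
  shows "0 \<le> W x1 t1"
proof (rule ccontr)
  assume neg: "\<not> 0 \<le> W x1 t1"
  \<comment> \<open>Every level between the negative value and 0 is a spatial minimum at some
    exceptional time; the image of the countable set \<open>N\<close> then contains an open
    interval.\<close>
  have "c \<in> (\<lambda>s. INF y\<in>K. W y s) ` N" if c: "W x1 t1 < c" "c < 0" for c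
  proof -
    define Z where "Z = {z \<in> K \<times> {s0..s1}. (case z of (x, t) \<Rightarrow> W x t) \<le> c}"
    have comp: "compact (K \<times> {s0..s1})" by (simp add: \<open>compact K\<close> compact_Times)
    have "Z = K \<times> {s0..s1} \<inter> (\<lambda>(x, t). W x t) -` {..c}" by (auto simp: Z_def)
    then have "closed Z"
      using continuous_closed_preimage[OF cont _ closed_atMost[of c]] comp compact_imp_closed by auto
    then have "compact Z"
      using comp compact_Int_closed[OF comp, of Z] by (simp add: Z_def Int_absorb1)
    moreover have "(x1, t1) \<in> Z" using assms c by (auto simp: Z_def)
    ultimately have "\<exists>z\<in>Z. \<forall>z'\<in>Z. snd z \<le> snd z'"
      by (intro continuous_attains_inf continuous_on_snd) (auto intro: continuous_on_id)
    then obtain z where z: "z \<in> Z" "\<forall>z'\<in>Z. snd z \<le> snd z'" by blast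
    obtain y s where ys: "z = (y, s)" by fastforce
    have y: "y \<in> K" "s \<in> {s0..s1}" "W y s \<le> c" using z(1) by (auto simp: Z_def ys)
    have first: "c < W y' s'" if "y' \<in> K" "s' \<in> {s0..<s}" for y' s'
    proof (rule ccontr)
      assume "\<not> c < W y' s'"
      then have "(y', s') \<in> Z" using that y by (auto simp: Z_def)
      with z(2) that show False by (fastforce simp: ys)
    qed
    have "s0 < s" using y init[OF y(1)] c by (cases "s = s0") auto
    \<comment> \<open>A value below \<open>c\<close> at time \<open>s\<close> would force the value
      \<open>c\<close> at an earlier time, because the start is nonnegative; but \<open>s\<close> is
      the earliest time at which the sublevel set is met.\<close>
    have ge: "c \<le> W y' s" if y': "y' \<in> K" for y'
    proof (rule ccontr)
      assume less: "\<not> c \<le> W y' s"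
      have "continuous_on {s0..s} (\<lambda>t. W y' t)"
        using continuous_on_compose2[OF cont, of "{s0..s}" "\<lambda>t. (y', t)"] y' y
          continuous_on_Pair[OF continuous_on_const continuous_on_id, of "{s0..s}" y']
        by fastforce
      then obtain s' where "s0 \<le> s'" "s' \<le> s" "W y' s' = c"
        using IVT2'[of "\<lambda>t. W y' t" s c s0] less init[OF y'] c \<open>s0 < s\<close> by auto
      then show False using first[OF y', of s'] less by (cases "s' = s") auto
    qed
    have eq: "W y s = c" using ge y by force
    have "s \<in> N"
    proof (rule ccontr)
      assume "s \<notin> N"
      show False
      proof (rule no_min[of y s])
        show "W y s \<le> W y' s" if "y' \<in> K" for y' using ge[OF that] eq by simp
        show "W y s \<le> W y s'" if "s' \<in> {s0..s}" for s'
          using first[OF y(1), of s'] that eq by (cases "s' = s") auto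
      qed (use y \<open>s0 < s\<close> \<open>s \<notin> N\<close> eq c in auto)
    qed
    moreover have "(INF y\<in>K. W y s) = c"
      using y(1) eq ge by (intro cInf_eq_minimum) (auto simp: image_iff)
    ultimately show ?thesis by auto
  qed
  then have "{W x1 t1<..<0} \<subseteq> (\<lambda>s. INF y\<in>K. W y s) ` N" by auto
  then have "countable {W x1 t1<..<0}" using \<open>countable N\<close> countable_subset by blast
  then show False using neg uncountable_open_interval[of "W x1 t1" 0] by simp
qed

text \<open>If \<open>D < 0\<close>, then \<open>k'\<close>, which vanishes at the minimum, is
  negative just to the right of 0, and the mean value theorem makes \<open>k\<close> drop below
  \<open>k 0\<close>.\<close>

lemma second_derivative_nonneg_at_min:
  fixes k k' :: "real \<Rightarrow> real"
  assumes d1: "\<forall>\<^sub>F s in nhds 0. (k has_real_derivative k' s) (at s)"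
    and d2: "(k' has_real_derivative D) (at 0)"
    and min: "\<forall>\<^sub>F s in nhds 0. k 0 \<le> k s"
  shows "0 \<le> D"
proof (rule ccontr)
  assume "\<not> 0 \<le> D"
  obtain e where e: "e > 0" "\<And>s. \<bar>s\<bar> < e \<Longrightarrow> (k has_real_derivative k' s) (at s)" "\<And>s. \<bar>s\<bar> < e \<Longrightarrow> k 0 \<le> k s"
    using eventually_conj[OF d1 min] unfolding eventually_nhds_metric by (auto simp: dist_real_def)
  have "k' 0 = 0"
    using DERIV_local_min[OF e(2)[of 0] e(1)] e by auto
  then obtain d where d: "d > 0" "\<And>h. 0 < h \<Longrightarrow> h < d \<Longrightarrow> k' h < 0"
    using DERIV_neg_dec_right[OF d2] \<open>\<not> 0 \<le> D\<close> by auto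
  define s where "s = min e d / 2"
  have s: "0 < s" "s < e" "s < d" using e d by (auto simp: s_def)
  obtain z where z: "0 < z" "z < s" "k s - k 0 = (s - 0) * k' z"
    using MVT2[OF s(1), of k k'] e(2) s by auto
  then have "k s - k 0 < 0" using d(2)[of z] s by (simp add: mult_pos_neg)
  then show False using e(3)[of s] s by auto
qed

text \<open>A first-crossing argument compares with earlier times only. This still controls one
  sign: a positive derivative would mean smaller values just before \<open>t\<close>.\<close>

lemma derivative_nonpos_at_left_min:
  fixes k :: "real \<Rightarrow> real"
  assumes "(k has_real_derivative D) (at t)" and min: "\<And>s. s \<in> {s0..t} \<Longrightarrow> k t \<le> k s" and "s0 < t"
  shows "D \<le> 0"
proof (rule ccontr)
  assume "\<not> D \<le> 0"
  then obtain d where d: "d > 0" "\<And>h. 0 < h \<Longrightarrow> h < d \<Longrightarrow> k (t - h) < k t"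
    using DERIV_pos_inc_left[OF assms(1)] by auto
  have "k (t - min (d/2) (t - s0)) < k t" using d \<open>s0 < t\<close> by (intro d(2)) auto
  moreover have "k t \<le> k (t - min (d/2) (t - s0))" using d \<open>s0 < t\<close> by (intro min) auto
  ultimately show False by simp
qed

subsection \<open>Twice differentiable functions\<close>

text \<open>Second derivatives need only exist, not be continuous; this suffices for the
  second-derivative test at a single point.\<close>

definition twice_diff_on :: "'a::euclidean_space set \<Rightarrow> ('a \<Rightarrow> real) \<Rightarrow> bool" where
  "twice_diff_on S k \<longleftrightarrow> (\<forall>x\<in>S. k differentiable (at x) \<and>
     (\<forall>b\<in>Basis. (\<lambda>y. frechet_derivative k (at y) b) differentiable (at x)))"

lemma Ck_on_2_imp_twice_diff_on: "Ck_on 2 S k \<Longrightarrow> twice_diff_on S k"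
  by (auto simp: twice_diff_on_def numeral_2_eq_2)

lemma frechet_derivative_eq_grad:
  assumes "k differentiable (at x)"
  shows "frechet_derivative k (at x) v = grad k x \<bullet> v"
proof -
  interpret bounded_linear "frechet_derivative k (at x)"
    using assms frechet_derivative_works has_derivative_bounded_linear by blast
  have "frechet_derivative k (at x) v = frechet_derivative k (at x) (\<Sum>b\<in>Basis. (v \<bullet> b) *\<^sub>R b)"
    by (simp add: euclidean_representation)
  also have "\<dots> = (\<Sum>b\<in>Basis. (v \<bullet> b) * frechet_derivative k (at x) b)"
    by (simp add: sum scaleR)
  also have "\<dots> = grad k x \<bullet> v"
    by (simp add: grad_def inner_sum_left inner_commute[of v] mult.commute)
  finally show ?thesis .
qed

lemma has_real_derivative_along_line:
  fixes k :: "'a::real_normed_vector \<Rightarrow> real"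
  assumes "k differentiable (at (x + s *\<^sub>R v))"
  shows "((\<lambda>s. k (x + s *\<^sub>R v)) has_real_derivative frechet_derivative k (at (x + s *\<^sub>R v)) v) (at s)"
proof -
  have D: "(k has_derivative frechet_derivative k (at (x + s *\<^sub>R v))) (at (x + s *\<^sub>R v))"
    using assms frechet_derivative_works by blast
  have "((\<lambda>s. x + s *\<^sub>R v) has_derivative (\<lambda>h. h *\<^sub>R v)) (at s)"
    by (auto intro!: derivative_eq_intros)
  from has_derivative_compose[OF this D]
  have "((\<lambda>s. k (x + s *\<^sub>R v)) has_derivative (\<lambda>h. frechet_derivative k (at (x + s *\<^sub>R v)) (h *\<^sub>R v))) (at s)" .
  moreover have "(\<lambda>h. frechet_derivative k (at (x + s *\<^sub>R v)) (h *\<^sub>R v))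
      = (*) (frechet_derivative k (at (x + s *\<^sub>R v)) v)"
    using linear_scale[OF bounded_linear.linear[OF has_derivative_bounded_linear[OF D]]] by auto
  ultimately show ?thesis by (simp add: has_field_derivative_def)
qed

lemma eventually_along_line:
  fixes x :: "'a::real_normed_vector"
  assumes "\<forall>\<^sub>F y in nhds x. P y"
  shows "\<forall>\<^sub>F s in nhds 0. P (x + s *\<^sub>R v)"
proof -
  have "((\<lambda>s. x + s *\<^sub>R v) \<longlongrightarrow> x + 0 *\<^sub>R v) (nhds 0)"
    by (intro tendsto_intros filterlim_ident)
  then show ?thesis using assms by (simp add: filterlim_iff)
qed

lemma twice_diff_on_line_derivatives:
  assumes "twice_diff_on S k" "open S" "x \<in> S" "b \<in> Basis"
  shows "\<forall>\<^sub>F s in nhds 0. ((\<lambda>s. k (x + s *\<^sub>R b)) has_real_derivative frechet_derivative k (at (x + s *\<^sub>R b)) b) (at s)"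
    and "((\<lambda>s. frechet_derivative k (at (x + s *\<^sub>R b)) b) has_real_derivative
           frechet_derivative (\<lambda>y. frechet_derivative k (at y) b) (at x) b) (at 0)"
proof -
  show "\<forall>\<^sub>F s in nhds 0. ((\<lambda>s. k (x + s *\<^sub>R b)) has_real_derivative frechet_derivative k (at (x + s *\<^sub>R b)) b) (at s)"
    using eventually_along_line[OF eventually_nhds_in_open[OF assms(2,3)], of b]
    by eventually_elim (use assms in \<open>auto simp: twice_diff_on_def intro!: has_real_derivative_along_line\<close>)
  show "((\<lambda>s. frechet_derivative k (at (x + s *\<^sub>R b)) b) has_real_derivative
           frechet_derivative (\<lambda>y. frechet_derivative k (at y) b) (at x) b) (at 0)"
    using has_real_derivative_along_line[of "\<lambda>y. frechet_derivative k (at y) b" x 0 b] assms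
    by (auto simp: twice_diff_on_def)
qed

lemma frechet_derivative_diff':
  fixes k l :: "'a::real_normed_vector \<Rightarrow> real"
  assumes "k differentiable (at x)" "l differentiable (at x)"
  shows "frechet_derivative (\<lambda>y. k y - l y) (at x) b = frechet_derivative k (at x) b - frechet_derivative l (at x) b"
  using frechet_derivative_at[OF has_derivative_diff[OF assms[unfolded frechet_derivative_works]]]
  by metis

lemma twice_diff_on_diff:
  assumes k: "twice_diff_on S k" and l: "twice_diff_on S l" and "open S"
  shows "twice_diff_on S (\<lambda>y. k y - l y)"
    and "x \<in> S \<Longrightarrow> laplacian (\<lambda>y. k y - l y) x = laplacian k x - laplacian l x"
proof -
  have eq: "frechet_derivative (\<lambda>y. k y - l y) (at x) b = frechet_derivative k (at x) b - frechet_derivative l (at x) b"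
    if "x \<in> S" for x b
    using that k l by (auto simp: twice_diff_on_def intro!: frechet_derivative_diff')
  have D: "((\<lambda>y. frechet_derivative (\<lambda>y. k y - l y) (at y) b) has_derivative
      (\<lambda>v. frechet_derivative (\<lambda>y. frechet_derivative k (at y) b) (at x) v
         - frechet_derivative (\<lambda>y. frechet_derivative l (at y) b) (at x) v)) (at x)"
    if "x \<in> S" "b \<in> Basis" for x b
  proof (rule has_derivative_transform_within_open[OF _ \<open>open S\<close> that(1)])
    show "((\<lambda>y. frechet_derivative k (at y) b - frechet_derivative l (at y) b) has_derivative
      (\<lambda>v. frechet_derivative (\<lambda>y. frechet_derivative k (at y) b) (at x) v
         - frechet_derivative (\<lambda>y. frechet_derivative l (at y) b) (at x) v)) (at x)"
      using that k l by (auto simp: twice_diff_on_def frechet_derivative_works intro!: has_derivative_diff)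
  qed (simp add: eq)
  show "twice_diff_on S (\<lambda>y. k y - l y)"
    using k l unfolding twice_diff_on_def by (blast intro: differentiable_diff differentiableI D)
  show "laplacian (\<lambda>y. k y - l y) x = laplacian k x - laplacian l x" if "x \<in> S"
    using frechet_derivative_at[OF D[OF that], symmetric]
    by (simp add: laplacian_def sum_subtractf)
qed

subsection \<open>Nonnegative supersolutions and spreading of positivity\<close>

text \<open>The equation is exact, with a source \<open>S\<close> known only to be nonnegative off
  \<open>N\<close>. The exceptional set is a parameter so that the times where a comparison function
  is not differentiable can be added to it. Without boundary and initial conditions the notion
  restricts to subintervals.\<close>

definition heat_supersolution ::
  "'a::euclidean_space set \<Rightarrow> real \<Rightarrow> real \<Rightarrow> real set \<Rightarrow> ('a \<Rightarrow> real \<Rightarrow> real) \<Rightarrow> ('a \<Rightarrow> real \<Rightarrow> real) \<Rightarrow> bool"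
  where
  "heat_supersolution \<Omega> s0 s1 N S w \<longleftrightarrow>
     continuous_on (\<Omega> \<times> {s0..s1}) (\<lambda>(x, t). w x t) \<and>
     (\<forall>t\<in>{s0<..s1}. twice_diff_on \<Omega> (\<lambda>x. w x t)) \<and> countable N \<and>
     (\<forall>t\<in>{s0<..s1} - N. \<forall>x\<in>\<Omega>. 0 \<le> S x t \<and>
        ((\<lambda>s. w x s) has_real_derivative laplacian (\<lambda>y. w y t) x + S x t) (at t))"

lemma heat_supersolution_subinterval:
  assumes "heat_supersolution \<Omega> s0 s1 N S w" "s0 \<le> a" "b \<le> s1"
  shows "heat_supersolution \<Omega> a b N S w"
  using assms unfolding heat_supersolution_def
  by (auto elim!: continuous_on_subset)

text \<open>A barrier enters only through a function \<open>g\<close> of one variable, its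
  restriction to a coordinate line or a function touching that restriction; it need not be
  differentiable on the whole space.\<close>

lemma second_derivative_at_min:
  fixes k :: "'a::euclidean_space \<Rightarrow> real"
  assumes k: "twice_diff_on S k" "open S" "x \<in> S" "b \<in> Basis"
    and min: "\<forall>\<^sub>F s in nhds 0. k x + g 0 \<le> k (x + s *\<^sub>R b) + g s"
    and g: "\<forall>\<^sub>F s in nhds 0. (g has_real_derivative g' s) (at s)" "(g' has_real_derivative D) (at 0)"
  shows "- D \<le> frechet_derivative (\<lambda>y. frechet_derivative k (at y) b) (at x) b"
proof -
  have "0 \<le> frechet_derivative (\<lambda>y. frechet_derivative k (at y) b) (at x) b + D"
  proof (rule second_derivative_nonneg_at_min)
    show "\<forall>\<^sub>F s in nhds 0. ((\<lambda>s. k (x + s *\<^sub>R b) + g s) has_real_derivative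
        frechet_derivative k (at (x + s *\<^sub>R b)) b + g' s) (at s)"
      using twice_diff_on_line_derivatives(1)[OF k] g(1)
      by eventually_elim (rule DERIV_add)
    show "((\<lambda>s. frechet_derivative k (at (x + s *\<^sub>R b)) b + g' s) has_real_derivative
        frechet_derivative (\<lambda>y. frechet_derivative k (at y) b) (at x) b + D) (at 0)"
      using twice_diff_on_line_derivatives(2)[OF k] g(2) by (rule DERIV_add)
    show "\<forall>\<^sub>F s in nhds 0. k (x + 0 *\<^sub>R b) + g 0 \<le> k (x + s *\<^sub>R b) + g s"
      using min by simp
  qed
  then show ?thesis by simp
qed

text \<open>The discriminant condition on \<open>\<mu>\<close> makes
  \<open>\<mu> q\<^sup>2 - (2 \<alpha> + 8 + 4 d) q + 8 (r\<^sup>2 + \<alpha> (t - s0))\<close> nonnegative. This is what the subsolution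
  inequality for \<open>A(t) q\<^sup>2\<close>, with \<open>q = r\<^sup>2 + \<alpha> (t - s0) - \<bar>x - p\<bar>\<^sup>2\<close>, amounts to.\<close>

lemma barrier_below_supersolution:
  fixes w :: "'a::euclidean_space \<Rightarrow> real \<Rightarrow> real"
  defines "Q \<equiv> \<lambda>\<alpha> r p s0 x t. r\<^sup>2 + \<alpha> * (t - s0) - (norm (x - p))\<^sup>2"
  assumes "open \<Omega>" and sub: "cball p R \<subseteq> \<Omega>" and w: "heat_supersolution \<Omega> s0 s1 N S w"
    and nonneg: "\<And>x t. x \<in> \<Omega> \<Longrightarrow> t \<in> {s0..s1} \<Longrightarrow> 0 \<le> w x t"
    and "r > 0" "\<alpha> \<ge> 0" "R > 0" and R: "r\<^sup>2 + \<alpha> * (s1 - s0) \<le> R\<^sup>2"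
    and A: "continuous_on {s0..s1} A" "\<And>t. t \<in> {s0..s1} \<Longrightarrow> 0 \<le> A t"
    and A': "\<And>t. t \<in> {s0<..s1} - N \<Longrightarrow> (A has_real_derivative A' t) (at t)"
    and ineq: "\<And>x t. t \<in> {s0<..s1} - N \<Longrightarrow> x \<in> \<Omega> \<Longrightarrow> 0 < Q \<alpha> r p s0 x t \<Longrightarrow>
        (A' t + \<mu> * A t) * (Q \<alpha> r p s0 x t)\<^sup>2 \<le> S x t"
    and disc: "(2 * \<alpha> + 8 + 4 * real DIM('a))\<^sup>2 \<le> 32 * \<mu> * r\<^sup>2"
    and init: "\<And>x. x \<in> \<Omega> \<Longrightarrow> A s0 * (max 0 (Q \<alpha> r p s0 x s0))\<^sup>2 \<le> w x s0"
    and x1: "x1 \<in> cball p R" and t1: "t1 \<in> {s0..s1}"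
  shows "A t1 * (max 0 (Q \<alpha> r p s0 x1 t1))\<^sup>2 \<le> w x1 t1"
proof -
  define q where "q = Q \<alpha> r p s0"
  have q: "q x t = r\<^sup>2 + \<alpha> * (t - s0) - (norm (x - p))\<^sup>2" for x t by (simp add: q_def Q_def)
  \<comment> \<open>The term \<open>\<epsilon> * (t - s0)\<close> makes the differential inequality
    strict at a minimum; \<epsilon> is arbitrary and is removed at the end.\<close>
  have perturbed: "0 \<le> w x1 t1 - A t1 * (max 0 (q x1 t1))\<^sup>2 + \<epsilon> * (t1 - s0)" if "\<epsilon> > 0" for \<epsilon>
  proof (rule parabolic_min_principle[where K = "cball p R" and N = N
        and W = "\<lambda>x t. w x t - A t * (max 0 (q x t))\<^sup>2 + \<epsilon> * (t - s0)"])
    have "continuous_on (cball p R \<times> {s0..s1}) (\<lambda>(x, t). w x t)"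
      using w sub unfolding heat_supersolution_def by (auto elim!: continuous_on_subset)
    moreover have "continuous_on (cball p R \<times> {s0..s1}) (\<lambda>z. A (snd z))"
      by (rule continuous_on_compose2[OF A(1)]) (auto intro: continuous_intros)
    ultimately show "continuous_on (cball p R \<times> {s0..s1}) (\<lambda>(x, t). w x t - A t * (max 0 (q x t))\<^sup>2 + \<epsilon> * (t - s0))"
      unfolding case_prod_beta q by (intro continuous_intros)
    show "0 \<le> w x s0 - A s0 * (max 0 (q x s0))\<^sup>2 + \<epsilon> * (s0 - s0)" if "x \<in> cball p R" for x
      using init[of x] that sub by (auto simp: q_def)
    fix x t assume x: "x \<in> cball p R" and t: "s0 < t" "t \<le> s1" "t \<notin> N"
      and neg: "w x t - A t * (max 0 (q x t))\<^sup>2 + \<epsilon> * (t - s0) < 0"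
      and xmin: "\<And>y. y \<in> cball p R \<Longrightarrow> w x t - A t * (max 0 (q x t))\<^sup>2 + \<epsilon> * (t - s0) \<le>
            w y t - A t * (max 0 (q y t))\<^sup>2 + \<epsilon> * (t - s0)"
      and tmin: "\<And>s. s \<in> {s0..t} \<Longrightarrow> w x t - A t * (max 0 (q x t))\<^sup>2 + \<epsilon> * (t - s0) \<le>
            w x s - A s * (max 0 (q x s))\<^sup>2 + \<epsilon> * (s - s0)"
    have x\<Omega>: "x \<in> \<Omega>" using x sub by auto
    have At: "0 \<le> A t" using A(2) t by simp
    have qpos: "0 < q x t"
    proof (rule ccontr)
      assume "\<not> 0 < q x t"
      then have "max 0 (q x t) = 0" by simp
      then have "w x t + \<epsilon> * (t - s0) < 0" using neg by simp
      moreover have "0 \<le> w x t" using nonneg[OF x\<Omega>, of t] t by simp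
      moreover have "0 \<le> \<epsilon> * (t - s0)" using t \<open>\<epsilon> > 0\<close> by simp
      ultimately show False by linarith
    qed
    have "\<alpha> * (t - s0) \<le> \<alpha> * (s1 - s0)" using \<open>\<alpha> \<ge> 0\<close> t by (intro mult_left_mono) auto
    then have "(norm (x - p))\<^sup>2 < R\<^sup>2" using qpos R unfolding q by linarith
    then have xball: "x \<in> ball p R"
      using \<open>R > 0\<close> by (simp add: dist_norm norm_minus_commute power2_less_imp_less)
    have pointwise_min: "\<forall>\<^sub>F y in nhds x. w x t + - A t * (q x t)\<^sup>2 \<le> w y t + - A t * (q y t)\<^sup>2"
    proof -
      have q_pos: "\<forall>\<^sub>F y in nhds x. 0 < q y t"
        using qpos by (intro order_tendstoD(1)[of "\<lambda>y. q y t" "q x t"]) (auto simp: q intro!: tendsto_eq_intros filterlim_ident)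
      have in_ball: "\<forall>\<^sub>F y in nhds x. y \<in> ball p R"
        using xball by (intro eventually_nhds_in_open) auto
      have "w x t + - A t * (q x t)\<^sup>2 \<le> w y t + - A t * (q y t)\<^sup>2"
        if "0 < q y t" "y \<in> ball p R" for y
        using xmin[of y] that qpos by (simp add: max_def)
      with q_pos in_ball show ?thesis by (auto elim: eventually_elim2)
    qed
    define c where "c b = (x - p) \<bullet> b" for b :: 'a
    have q_line: "q (x + s *\<^sub>R b) t = q x t - 2 * s * c b - s\<^sup>2" if "b \<in> Basis" for b s
      using that unfolding q c_def power2_norm_eq_inner
      by (simp add: inner_simps inner_commute power2_eq_square algebra_simps)
    have "- (- A t * (8 * (c b)\<^sup>2 - 4 * q x t)) \<le>
        frechet_derivative (\<lambda>y. frechet_derivative (\<lambda>y. w y t) (at y) b) (at x) b" if b: "b \<in> Basis" for b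
    proof (rule second_derivative_at_min[OF _ \<open>open \<Omega>\<close> x\<Omega> b, where g = "\<lambda>s. - A t * (q x t - 2 * s * c b - s\<^sup>2)\<^sup>2"])
      show "twice_diff_on \<Omega> (\<lambda>y. w y t)" using w t unfolding heat_supersolution_def by auto
      show "\<forall>\<^sub>F s in nhds 0. w x t + - A t * (q x t - 2 * 0 * c b - 0\<^sup>2)\<^sup>2
          \<le> w (x + s *\<^sub>R b) t + - A t * (q x t - 2 * s * c b - s\<^sup>2)\<^sup>2"
        using eventually_along_line[OF pointwise_min, of b] by (simp add: q_line[OF b])
      show "\<forall>\<^sub>F s in nhds 0. ((\<lambda>s. - A t * (q x t - 2 * s * c b - s\<^sup>2)\<^sup>2) has_real_derivative
          - A t * (2 * (q x t - 2 * s * c b - s\<^sup>2) * (- 2 * c b - 2 * s))) (at s)"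
        by (intro always_eventually allI) (auto intro!: derivative_eq_intros)
      show "((\<lambda>s. - A t * (2 * (q x t - 2 * s * c b - s\<^sup>2) * (- 2 * c b - 2 * s))) has_real_derivative
          - A t * (8 * (c b)\<^sup>2 - 4 * q x t)) (at 0)"
        by (auto intro!: derivative_eq_intros simp: power2_eq_square algebra_simps)
    qed
    then have lap: "(\<Sum>b\<in>Basis. - (- A t * (8 * (c b)\<^sup>2 - 4 * q x t))) \<le> laplacian (\<lambda>y. w y t) x"
      unfolding laplacian_def by (rule sum_mono)
    have "(\<Sum>b\<in>Basis. (c b)\<^sup>2) = (norm (x - p))\<^sup>2"
      unfolding c_def power2_norm_eq_inner by (subst euclidean_inner) (simp add: power2_eq_square)
    \<comment> \<open>The factor of \<open>A t\<close> is the Laplacian of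
      \<open>(q x t)\<^sup>2\<close> with respect to \<open>x\<close>.\<close>
    then have lap': "A t * (8 * (norm (x - p))\<^sup>2 - 4 * DIM('a) * q x t) \<le> laplacian (\<lambda>y. w y t) x"
      using lap by (simp add: sum_distrib_left[symmetric] sum_subtractf mult.left_commute mult.assoc)
    have "((\<lambda>s. w x s) has_real_derivative laplacian (\<lambda>y. w y t) x + S x t) (at t)"
      using w t x\<Omega> unfolding heat_supersolution_def by auto
    then have time_deriv: "((\<lambda>s. w x s - A s * (q x s)\<^sup>2 + \<epsilon> * (s - s0)) has_real_derivative
        laplacian (\<lambda>y. w y t) x + S x t - (A' t * (q x t)\<^sup>2 + A t * (2 * q x t * \<alpha>)) + \<epsilon>) (at t)"
      unfolding q using A'[of t] t
      by (auto intro!: derivative_eq_intros simp: algebra_simps)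
    have "\<forall>\<^sub>F s in nhds t. 0 < q x s"
      using qpos by (intro order_tendstoD(1)[of "\<lambda>s. q x s" "q x t"]) (auto simp: q intro!: tendsto_eq_intros filterlim_ident)
    then obtain d where d: "d > 0" "\<And>s. \<bar>s - t\<bar> < d \<Longrightarrow> 0 < q x s"
      by (auto simp: eventually_nhds_metric dist_real_def)
    \<comment> \<open>Looking back by at most \<open>d/2\<close> keeps \<open>q\<close> positive, so
      no positive part appears in the time derivative either.\<close>
    have "laplacian (\<lambda>y. w y t) x + S x t - (A' t * (q x t)\<^sup>2 + A t * (2 * q x t * \<alpha>)) + \<epsilon> \<le> 0"
    proof (rule derivative_nonpos_at_left_min[OF time_deriv, of "max s0 (t - d/2)"])
      fix s assume s: "s \<in> {max s0 (t - d/2)..t}"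
      then have "0 < q x s" using d by (intro d(2)) auto
      moreover have "s0 \<le> s" "s \<le> t" using s by auto
      ultimately show "w x t - A t * (q x t)\<^sup>2 + \<epsilon> * (t - s0) \<le> w x s - A s * (q x s)\<^sup>2 + \<epsilon> * (s - s0)"
        using tmin[of s] qpos by simp
    qed (use t d in auto)
    moreover have "(A' t + \<mu> * A t) * (q x t)\<^sup>2 \<le> S x t"
      using ineq[of t x] t x\<Omega> qpos by (simp add: q_def)
    ultimately have "A t * (8 * (norm (x - p))\<^sup>2 - 4 * DIM('a) * q x t + \<mu> * (q x t)\<^sup>2 - 2 * \<alpha> * q x t) + \<epsilon> \<le> 0"
      using lap' by (simp add: algebra_simps)
    moreover have "0 \<le> 8 * (norm (x - p))\<^sup>2 - 4 * DIM('a) * q x t + \<mu> * (q x t)\<^sup>2 - 2 * \<alpha> * q x t"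
    proof -
      \<comment> \<open>Replacing \<open>(norm (x - p))\<^sup>2\<close> by
        \<open>r\<^sup>2 + \<alpha> * (t - s0) - q x t\<close> gathers all terms linear in
        \<open>q\<close> into \<open>- B * q x t\<close>; completing the square leaves
        \<open>32 * (\<mu> * r\<^sup>2) - B\<^sup>2\<close>.\<close>
      define B where "B = 2 * \<alpha> + 8 + 4 * real DIM('a)"
      have disc': "B\<^sup>2 \<le> 32 * (\<mu> * r\<^sup>2)" using disc by (simp add: B_def)
      have "0 < B" using \<open>\<alpha> \<ge> 0\<close> by (simp add: B_def add_nonneg_pos)
      then have "0 < B\<^sup>2" by simp
      then have "0 < \<mu> * r\<^sup>2" using disc' by linarith
      then have "\<mu> > 0" by (simp add: zero_less_mult_iff)
      have "0 \<le> (2 * \<mu> * q x t - B)\<^sup>2 + (32 * (\<mu> * r\<^sup>2) - B\<^sup>2)" using disc' by simp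
      also have "\<dots> = 4 * \<mu> * (\<mu> * (q x t)\<^sup>2 - B * q x t + 8 * r\<^sup>2)"
        by (simp add: power2_eq_square algebra_simps)
      finally have "0 \<le> \<mu> * (q x t)\<^sup>2 - B * q x t + 8 * r\<^sup>2" using \<open>\<mu> > 0\<close> by (simp add: zero_le_mult_iff)
      moreover have "0 \<le> 8 * (\<alpha> * (t - s0))" using \<open>\<alpha> \<ge> 0\<close> t by simp
      moreover have "(norm (x - p))\<^sup>2 = r\<^sup>2 + \<alpha> * (t - s0) - q x t" by (simp add: q)
      ultimately show ?thesis by (simp add: B_def algebra_simps)
    qed
    ultimately show False using At \<open>\<epsilon> > 0\<close> by (smt (verit) mult_nonneg_nonneg)
  qed (use w x1 t1 in \<open>auto simp: heat_supersolution_def\<close>)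
  show ?thesis
  proof (rule field_le_epsilon)
    fix e :: real assume "e > 0"
    define \<epsilon> where "\<epsilon> = e / (s1 - s0 + 1)"
    have "s1 - s0 + 1 > 0" using t1 by auto
    then have "\<epsilon> > 0" "\<epsilon> * (s1 - s0 + 1) = e" using \<open>e > 0\<close> by (auto simp: \<epsilon>_def)
    moreover have "\<epsilon> * (t1 - s0) \<le> \<epsilon> * (s1 - s0 + 1)" using t1 \<open>\<epsilon> > 0\<close> by (intro mult_left_mono) auto
    ultimately show "A t1 * (max 0 (Q \<alpha> r p s0 x1 t1))\<^sup>2 \<le> w x1 t1 + e"
      using perturbed[of \<epsilon>] by (simp add: q_def)
  qed
qed

section \<open>Propagation of lower bounds from ball to ball\<close>

text \<open>The support of the barrier grows: \<alpha> makes its squared radius rise linearly from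
  \<open>r\<^sup>2\<close> to \<open>R\<^sup>2\<close>. Only the sign of the source is used, so the
  amplitude decays exponentially with \<open>A' + \<mu> * A = 0\<close>. Normalising the barrier to
  \<kappa> at the centre at time \<open>s0\<close> costs the factor \<open>r^4\<close>; at time
  \<open>s1\<close> its squared factor on the ball of radius \<open>R'\<close> is at least
  \<open>(R\<^sup>2 - R'\<^sup>2)\<^sup>2\<close>. Together these give \<open>c\<close>.\<close>

lemma positivity_expands:
  fixes p :: "'a::euclidean_space"
  assumes "open \<Omega>" "cball p R \<subseteq> \<Omega>" "0 < r" "r < R'" "R' < R" "s0 < s1"
  shows "\<exists>c>0. \<forall>N S w \<kappa>. heat_supersolution \<Omega> s0 s1 N S w \<longrightarrow>
     (\<forall>x\<in>\<Omega>. \<forall>t\<in>{s0..s1}. 0 \<le> w x t) \<longrightarrow> 0 \<le> \<kappa> \<longrightarrow> (\<forall>x\<in>ball p r. \<kappa> \<le> w x s0) \<longrightarrow>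
     (\<forall>x\<in>ball p R'. c * \<kappa> \<le> w x s1)"
proof -
  define \<alpha> where "\<alpha> = (R\<^sup>2 - r\<^sup>2) / (s1 - s0)"
  \<comment> \<open>The value of \<mu> with equality in the discriminant condition.\<close>
  define \<mu> where "\<mu> = (2 * \<alpha> + 8 + 4 * real DIM('a))\<^sup>2 / (32 * r\<^sup>2)"
  define c where "c = exp (- \<mu> * (s1 - s0)) * (R\<^sup>2 - R'\<^sup>2)\<^sup>2 / r^4"
  have "r\<^sup>2 < R\<^sup>2" "R'\<^sup>2 < R\<^sup>2" using assms by (auto intro!: power_strict_mono)
  then have "\<alpha> \<ge> 0" "c > 0" using assms by (auto simp: \<alpha>_def c_def)
  have \<alpha>: "\<alpha> * (s1 - s0) = R\<^sup>2 - r\<^sup>2" using assms by (simp add: \<alpha>_def)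
  have "c * \<kappa> \<le> w x s1"
    if w: "heat_supersolution \<Omega> s0 s1 N S w" "\<forall>x\<in>\<Omega>. \<forall>t\<in>{s0..s1}. 0 \<le> w x t"
      and \<kappa>: "0 \<le> \<kappa>" "\<forall>x\<in>ball p r. \<kappa> \<le> w x s0" and x: "x \<in> ball p R'" for N S w \<kappa> x
  proof -
    let ?A = "\<lambda>t. \<kappa> / r^4 * exp (- \<mu> * (t - s0))"
    have "?A s1 * (max 0 (r\<^sup>2 + \<alpha> * (s1 - s0) - (norm (x - p))\<^sup>2))\<^sup>2 \<le> w x s1"
    proof (rule barrier_below_supersolution[OF \<open>open \<Omega>\<close> assms(2) w(1), where \<mu> = \<mu> and A' = "\<lambda>t. - \<mu> * ?A t"])
      show "?A s0 * (max 0 (r\<^sup>2 + \<alpha> * (s0 - s0) - (norm (y - p))\<^sup>2))\<^sup>2 \<le> w y s0" if "y \<in> \<Omega>" for y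
      proof (cases "y \<in> ball p r")
        case True
        then have "(norm (y - p))\<^sup>2 \<le> r\<^sup>2"
          by (intro power_mono) (auto simp: dist_norm norm_minus_commute)
        then have "(max 0 (r\<^sup>2 - (norm (y - p))\<^sup>2))\<^sup>2 \<le> (r\<^sup>2)\<^sup>2"
          by (intro power_mono) auto
        then have "\<kappa> / r^4 * (max 0 (r\<^sup>2 - (norm (y - p))\<^sup>2))\<^sup>2 \<le> \<kappa> / r^4 * (r\<^sup>2)\<^sup>2"
          using \<kappa> by (intro mult_left_mono) auto
        then show ?thesis using \<kappa>(2) True \<open>0 < r\<close> by (simp add: power_mult[symmetric]) force
      next
        case False
        then have "r\<^sup>2 \<le> (norm (y - p))\<^sup>2"
          using \<open>0 < r\<close> by (intro power_mono) (auto simp: dist_norm norm_minus_commute)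
        then show ?thesis using w(2) that \<open>s0 < s1\<close> by simp
      qed
      have "0 \<le> S y t" if "t \<in> {s0<..s1} - N" "y \<in> \<Omega>" for y t
        using w(1) that by (auto simp: heat_supersolution_def)
      then show "(- \<mu> * ?A t + \<mu> * ?A t) * (r\<^sup>2 + \<alpha> * (t - s0) - (norm (y - p))\<^sup>2)\<^sup>2 \<le> S y t"
        if "t \<in> {s0<..s1} - N" "y \<in> \<Omega>" for y t
        using that by simp
      have "((\<lambda>t. k * exp (- \<mu> * (t - s0))) has_real_derivative - \<mu> * (k * exp (- \<mu> * (t - s0)))) (at t)" for k t
        by (auto intro!: derivative_eq_intros)
      then show "(?A has_real_derivative - \<mu> * ?A t) (at t)" for t .
      show "(2 * \<alpha> + 8 + 4 * real DIM('a))\<^sup>2 \<le> 32 * \<mu> * r\<^sup>2"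
        using \<open>0 < r\<close> by (simp add: \<mu>_def)
    qed (use assms w \<alpha> \<kappa> x \<open>\<alpha> \<ge> 0\<close> in \<open>auto intro!: continuous_intros\<close>)
    moreover have "(R\<^sup>2 - R'\<^sup>2)\<^sup>2 \<le> (max 0 (r\<^sup>2 + \<alpha> * (s1 - s0) - (norm (x - p))\<^sup>2))\<^sup>2"
    proof (rule power_mono)
      have "(norm (x - p))\<^sup>2 \<le> R'\<^sup>2"
        using x by (intro power_mono) (auto simp: dist_norm norm_minus_commute)
      then show "R\<^sup>2 - R'\<^sup>2 \<le> max 0 (r\<^sup>2 + \<alpha> * (s1 - s0) - (norm (x - p))\<^sup>2)"
        using \<alpha> by linarith
    qed (use \<open>R'\<^sup>2 < R\<^sup>2\<close> in simp)
    then have "?A s1 * (R\<^sup>2 - R'\<^sup>2)\<^sup>2 \<le> ?A s1 * (max 0 (r\<^sup>2 + \<alpha> * (s1 - s0) - (norm (x - p))\<^sup>2))\<^sup>2"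
      using \<kappa> by (intro mult_left_mono) auto
    ultimately show ?thesis by (simp add: c_def mult_ac)
  qed
  with \<open>c > 0\<close> show ?thesis by blast
qed

text \<open>Connectedness replaces an explicit chain of balls: near each point of \<Omega>, being
  reached passes from any point to any other.\<close>

lemma positivity_spreads:
  fixes \<Omega> :: "'a::euclidean_space set"
  assumes "open \<Omega>" "connected \<Omega>" "y \<in> \<Omega>" "z \<in> \<Omega>" "0 < r0" "\<tau>0 < T"
  shows "\<exists>c>0. \<forall>N S w \<kappa>. heat_supersolution \<Omega> \<tau>0 T N S w \<longrightarrow>
     (\<forall>x\<in>\<Omega>. \<forall>t\<in>{\<tau>0..T}. 0 \<le> w x t) \<longrightarrow> 0 \<le> \<kappa> \<longrightarrow> (\<forall>x\<in>ball y r0. \<kappa> \<le> w x \<tau>0) \<longrightarrow>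
     c * \<kappa> \<le> w z T"
proof -
  \<comment> \<open>Admitting every \<tau> lets each step spend half of the elapsed time, so the
    number of steps need not be known in advance. A whole ball around \<open>z\<close> is recorded
    because the next step starts from a ball.\<close>
  define P where "P z \<longleftrightarrow> (\<forall>\<tau>\<in>{\<tau>0<..T}. \<exists>c>0. \<exists>r>0. \<forall>N S w \<kappa>.
     heat_supersolution \<Omega> \<tau>0 T N S w \<longrightarrow> (\<forall>x\<in>\<Omega>. \<forall>t\<in>{\<tau>0..T}. 0 \<le> w x t) \<longrightarrow> 0 \<le> \<kappa> \<longrightarrow>
     (\<forall>x\<in>ball y r0. \<kappa> \<le> w x \<tau>0) \<longrightarrow> (\<forall>x\<in>ball z r. c * \<kappa> \<le> w x \<tau>))" for z
  have "P y"
    unfolding P_def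
  proof
    fix \<tau> assume \<tau>: "\<tau> \<in> {\<tau>0<..T}"
    obtain R where R: "R > 0" "cball y R \<subseteq> \<Omega>"
      using assms open_contains_cball by blast
    define r where "r = min r0 R / 3"
    have r: "0 < r" "r < 2 * r" "2 * r < R" "r \<le> r0" using R assms by (auto simp: r_def)
    from positivity_expands[OF \<open>open \<Omega>\<close> R(2) r(1-3), of \<tau>0 \<tau>] \<tau>
    obtain c where c: "c > 0" "\<And>N S w \<kappa>. heat_supersolution \<Omega> \<tau>0 \<tau> N S w \<Longrightarrow>
     (\<forall>x\<in>\<Omega>. \<forall>t\<in>{\<tau>0..\<tau>}. 0 \<le> w x t) \<Longrightarrow> 0 \<le> \<kappa> \<Longrightarrow> (\<forall>x\<in>ball y r. \<kappa> \<le> w x \<tau>0) \<Longrightarrow>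
     (\<forall>x\<in>ball y (2 * r). c * \<kappa> \<le> w x \<tau>)" by auto
    have "\<forall>x\<in>ball y (2 * r). c * \<kappa> \<le> w x \<tau>"
      if w: "heat_supersolution \<Omega> \<tau>0 T N S w" "\<forall>x\<in>\<Omega>. \<forall>t\<in>{\<tau>0..T}. 0 \<le> w x t"
        "0 \<le> \<kappa>" "\<forall>x\<in>ball y r0. \<kappa> \<le> w x \<tau>0" for N S w \<kappa>
      by (rule c(2)[OF heat_supersolution_subinterval[OF w(1)]]) (use w \<tau> r in auto)
    with c(1) r show "\<exists>c>0. \<exists>r>0. \<forall>N S w \<kappa>. heat_supersolution \<Omega> \<tau>0 T N S w \<longrightarrow>
      (\<forall>x\<in>\<Omega>. \<forall>t\<in>{\<tau>0..T}. 0 \<le> w x t) \<longrightarrow> 0 \<le> \<kappa> \<longrightarrow>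
     (\<forall>x\<in>ball y r0. \<kappa> \<le> w x \<tau>0) \<longrightarrow> (\<forall>x\<in>ball y r. c * \<kappa> \<le> w x \<tau>)"
      by (intro exI[of _ c] conjI exI[of _ "2 * r"]) auto
  qed
  have step: "P v" if "P u" "cball u R \<subseteq> \<Omega>" "v \<in> ball u R" for u v R
    unfolding P_def
  proof
    fix \<tau> assume \<tau>: "\<tau> \<in> {\<tau>0<..T}"
    define \<tau>' where "\<tau>' = (\<tau>0 + \<tau>) / 2"
    have \<tau>': "\<tau>0 < \<tau>'" "\<tau>' < \<tau>" "\<tau>' \<le> T" using \<tau> by (auto simp: \<tau>'_def)
    obtain c r where cr: "c > 0" "r > 0" "\<And>N S w \<kappa>.
     heat_supersolution \<Omega> \<tau>0 T N S w \<Longrightarrow> (\<forall>x\<in>\<Omega>. \<forall>t\<in>{\<tau>0..T}. 0 \<le> w x t) \<Longrightarrow> 0 \<le> \<kappa> \<Longrightarrow>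
     (\<forall>x\<in>ball y r0. \<kappa> \<le> w x \<tau>0) \<Longrightarrow> (\<forall>x\<in>ball u r. c * \<kappa> \<le> w x \<tau>')"
      using \<open>P u\<close>[unfolded P_def, rule_format, of \<tau>'] \<tau>' by auto
    \<comment> \<open>With \<open>R'\<close> strictly between \<open>dist u v\<close> and
      \<open>R\<close>, the enlarged ball around \<open>u\<close> contains a ball around
      \<open>v\<close>.\<close>
    define R' where "R' = (dist u v + R) / 2"
    have R': "dist u v < R'" "0 < R'" "R' < R"
      using that(3) zero_le_dist[of u v] by (auto simp: R'_def simp del: zero_le_dist)
    define r' where "r' = min r (R' / 2)"
    have r': "0 < r'" "r' < R'" "r' \<le> r" using cr R' by (auto simp: r'_def)
    from positivity_expands[OF \<open>open \<Omega>\<close> that(2) r'(1,2) R'(3) \<tau>'(2)]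
    obtain c' where c': "c' > 0" "\<And>N S w \<kappa>. heat_supersolution \<Omega> \<tau>' \<tau> N S w \<Longrightarrow>
     (\<forall>x\<in>\<Omega>. \<forall>t\<in>{\<tau>'..\<tau>}. 0 \<le> w x t) \<Longrightarrow> 0 \<le> \<kappa> \<Longrightarrow> (\<forall>x\<in>ball u r'. \<kappa> \<le> w x \<tau>') \<Longrightarrow>
     (\<forall>x\<in>ball u R'. c' * \<kappa> \<le> w x \<tau>)" by blast
    have "c' * c * \<kappa> \<le> w x \<tau>"
      if w: "heat_supersolution \<Omega> \<tau>0 T N S w" "\<forall>x\<in>\<Omega>. \<forall>t\<in>{\<tau>0..T}. 0 \<le> w x t"
        "0 \<le> \<kappa>" "\<forall>x\<in>ball y r0. \<kappa> \<le> w x \<tau>0" and x: "x \<in> ball v (R' - dist u v)" for N S w \<kappa> x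
    proof -
      have "\<forall>x\<in>ball u R'. c' * (c * \<kappa>) \<le> w x \<tau>"
        by (rule c'(2)[OF heat_supersolution_subinterval[OF w(1)]]) (use w cr(1) cr(3)[OF w] \<tau> \<tau>' r' in auto)
      moreover have "dist u x < R'" using x dist_triangle[of u x v] by simp
      ultimately show ?thesis by (simp add: mult.assoc)
    qed
    then show "\<exists>c>0. \<exists>r>0. \<forall>N S w \<kappa>. heat_supersolution \<Omega> \<tau>0 T N S w \<longrightarrow>
      (\<forall>x\<in>\<Omega>. \<forall>t\<in>{\<tau>0..T}. 0 \<le> w x t) \<longrightarrow> 0 \<le> \<kappa> \<longrightarrow>
     (\<forall>x\<in>ball y r0. \<kappa> \<le> w x \<tau>0) \<longrightarrow> (\<forall>x\<in>ball v r. c * \<kappa> \<le> w x \<tau>)"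
      using cr(1) c'(1) R'(1)
      by (intro exI[of _ "c' * c"] conjI exI[of _ "R' - dist u v"]) auto
  qed
  have "P z"
  proof (rule connected_induction_simple[where P = P, OF \<open>connected \<Omega>\<close> \<open>y \<in> \<Omega>\<close> \<open>z \<in> \<Omega>\<close> \<open>P y\<close>])
    fix x assume "x \<in> \<Omega>"
    then obtain R where R: "R > 0" "cball x R \<subseteq> \<Omega>"
      using assms open_contains_cball by blast
    \<comment> \<open>Two points of the ball of radius \<open>R / 4\<close> are less than
      \<open>R / 2\<close> apart, and the closed ball of radius \<open>R / 2\<close> around either
      of them stays within \<open>cball x R\<close>.\<close>
    have spread: "P v" if "u \<in> ball x (R / 4)" "v \<in> ball x (R / 4)" "P u" for u v
    proof (rule step[OF \<open>P u\<close>, of "R / 2"])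
      show "cball u (R / 2) \<subseteq> \<Omega>"
      proof
        fix v' assume "v' \<in> cball u (R / 2)"
        then have "v' \<in> cball x R" using that R(1) dist_triangle[of x v' u] by simp
        then show "v' \<in> \<Omega>" using R by blast
      qed
      show "v \<in> ball u (R / 2)" using that dist_triangle3[of u v x] by simp
    qed
    have "ball x (R / 4) \<subseteq> \<Omega>" using R by (force simp: subset_iff)
    then have "openin (top_of_set \<Omega>) (ball x (R / 4))" by (intro open_subset) auto
    moreover have "x \<in> ball x (R / 4)" using R(1) by simp
    ultimately show "\<exists>U. openin (top_of_set \<Omega>) U \<and> x \<in> U \<and> (\<forall>u\<in>U. \<forall>v\<in>U. P u \<longrightarrow> P v)"
      using spread by blast
  qed
  have "T \<in> {\<tau>0<..T}" using \<open>\<tau>0 < T\<close> by simp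
  from bspec[OF \<open>P z\<close>[unfolded P_def] this] obtain c r where cr: "c > 0" "r > 0"
    and *: "\<forall>N S w \<kappa>. heat_supersolution \<Omega> \<tau>0 T N S w \<longrightarrow>
     (\<forall>x\<in>\<Omega>. \<forall>t\<in>{\<tau>0..T}. 0 \<le> w x t) \<longrightarrow> 0 \<le> \<kappa> \<longrightarrow> (\<forall>x\<in>ball y r0. \<kappa> \<le> w x \<tau>0) \<longrightarrow>
     (\<forall>x\<in>ball z r. c * \<kappa> \<le> w x T)"
    by (elim exE conjE)
  have "z \<in> ball z r" using cr(2) by simp
  with cr(1) * show ?thesis by (intro exI[of _ c]) blast
qed

subsection \<open>The Neumann condition\<close>

lemma local_defining_function_smooth:
  assumes "local_defining_function \<Omega> p U \<rho>"
  shows "open U" "p \<in> U" "continuous_on U \<rho>" "twice_diff_on U \<rho>"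
    and "b \<in> Basis \<Longrightarrow> continuous_on U (\<lambda>x. frechet_derivative \<rho> (at x) b)"
    and "b \<in> Basis \<Longrightarrow> continuous_on U (\<lambda>x. frechet_derivative (\<lambda>y. frechet_derivative \<rho> (at y) b) (at x) b)"
proof -
  have "smooth_on U \<rho>" and U: "open U" "p \<in> U"
    using assms by (auto simp: local_defining_function_def)
  then have C: "Ck_on k U \<rho>" for k by (simp add: smooth_on_def)
  show "open U" "p \<in> U" by fact+
  show "continuous_on U \<rho>" using C[of 0] by simp
  show "twice_diff_on U \<rho>" using C by (rule Ck_on_2_imp_twice_diff_on)
  then show "continuous_on U (\<lambda>x. frechet_derivative \<rho> (at x) b)" if "b \<in> Basis"
    using that by (auto simp: twice_diff_on_def intro!: continuous_at_imp_continuous_on differentiable_imp_continuous_within)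
  show "continuous_on U (\<lambda>x. frechet_derivative (\<lambda>y. frechet_derivative \<rho> (at y) b) (at x) b)" if "b \<in> Basis"
    using C[of 2] that by (simp add: numeral_2_eq_2)
qed

text \<open>A negative value would put \<open>p'\<close> into the open set \<Omega>, a positive one
  would separate \<open>p'\<close> from \<Omega>. So one defining function serves all boundary
  points in \<open>U\<close>, which lets a local barrier be examined away from its centre.\<close>

lemma local_defining_function_boundary:
  assumes "open \<Omega>" "local_defining_function \<Omega> p U \<rho>" "p' \<in> frontier \<Omega>" "p' \<in> U"
  shows "local_defining_function \<Omega> p' U \<rho>" and "\<rho> p' = 0"
proof -
  note * = local_defining_function_smooth[OF assms(2)]
  have \<Omega>: "\<Omega> \<inter> U = {x \<in> U. \<rho> x < 0}" using assms(2) by (auto simp: local_defining_function_def)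
  have "p' \<notin> \<Omega>" using assms(1,3) by (simp add: frontier_def interior_open)
  then have "0 \<le> \<rho> p'" using \<Omega> assms(4) by force
  moreover have "\<not> 0 < \<rho> p'"
  proof
    assume "0 < \<rho> p'"
    have "open (U \<inter> \<rho> -` {0<..})"
      using *(1,3) by (simp add: continuous_on_open_vimage open_greaterThan Int_commute)
    moreover have "p' \<in> U \<inter> \<rho> -` {0<..}" using \<open>0 < \<rho> p'\<close> assms(4) by simp
    moreover have "p' \<in> closure \<Omega>" using assms(3) by (simp add: frontier_def)
    ultimately have "\<Omega> \<inter> (U \<inter> \<rho> -` {0<..}) \<noteq> {}"
      using open_Int_closure_eq_empty by blast
    then show False using \<Omega> by force
  qed
  ultimately show "\<rho> p' = 0" by simp
  show "local_defining_function \<Omega> p' U \<rho>" using assms by (auto simp: local_defining_function_def)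
qed

lemma local_defining_function_line_derivative:
  assumes "local_defining_function \<Omega> p U \<rho>"
  shows "((\<lambda>s. \<rho> (p + s *\<^sub>R v)) has_real_derivative grad \<rho> p \<bullet> v) (at 0)"
proof -
  have "\<rho> differentiable (at p)"
    using local_defining_function_smooth[OF assms] by (simp add: twice_diff_on_def)
  then show ?thesis
    using has_real_derivative_along_line[of \<rho> p 0 v] by (simp add: frechet_derivative_eq_grad)
qed

lemma eventually_in_domain:
  assumes "open \<Omega>" "local_defining_function \<Omega> p U \<rho>" "p \<in> frontier \<Omega>" "grad \<rho> p \<bullet> v < 0"
  shows "\<forall>\<^sub>F s in at_right 0. p + s *\<^sub>R v \<in> \<Omega>"
proof -
  note * = local_defining_function_smooth[OF assms(2)]
  have "\<rho> p = 0" using local_defining_function_boundary assms * by blast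
  obtain d where "d > 0" "\<And>h. 0 < h \<Longrightarrow> h < d \<Longrightarrow> \<rho> (p + h *\<^sub>R v) < 0"
    using DERIV_neg_dec_right[OF local_defining_function_line_derivative[OF assms(2)] assms(4)] \<open>\<rho> p = 0\<close>
    by auto
  then have "\<forall>\<^sub>F s in at_right 0. \<rho> (p + s *\<^sub>R v) < 0"
    by (auto simp: eventually_at_right_field intro!: exI[of _ d])
  moreover have "\<forall>\<^sub>F s in at_right 0. p + s *\<^sub>R v \<in> U"
    using eventually_along_line[OF eventually_nhds_in_open[OF *(1,2)], of v]
    by (auto simp: eventually_at_filter elim: eventually_mono)
  ultimately show ?thesis
    by eventually_elim (use assms(2) in \<open>auto simp: local_defining_function_def\<close>)
qed

text \<open>All local defining functions at a boundary point have gradients in the same direction: if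
  \<open>A \<bullet> B \<le> 0\<close>, then \<open>B - A\<close> would point into the domain according to \<open>A\<close> and out of it according
  to \<open>B\<close>.\<close>

lemma outward_normal_pos:
  assumes "open \<Omega>" "local_defining_function \<Omega> p U \<rho>" "p \<in> frontier \<Omega>"
  shows "0 < grad \<rho> p \<bullet> outward_normal \<Omega> p"
proof -
  have "\<exists>n U \<rho>. local_defining_function \<Omega> p U \<rho> \<and> n = sgn (grad \<rho> p)" using assms(2) by blast
  from someI_ex[OF this] obtain U' \<rho>' where
    *: "local_defining_function \<Omega> p U' \<rho>'" "outward_normal \<Omega> p = sgn (grad \<rho>' p)"
    unfolding outward_normal_def by blast
  define A B where "A = grad \<rho>' p" and "B = grad \<rho> p"
  have "A \<noteq> 0" using * by (auto simp: local_defining_function_def A_def)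
  have "B \<noteq> 0" using assms by (auto simp: local_defining_function_def B_def)
  have "0 < A \<bullet> B"
  proof (rule ccontr)
    assume "\<not> 0 < A \<bullet> B"
    moreover have "0 < A \<bullet> A" "0 < B \<bullet> B" using \<open>A \<noteq> 0\<close> \<open>B \<noteq> 0\<close> by auto
    moreover have "A \<bullet> (B - A) = A \<bullet> B - A \<bullet> A" "B \<bullet> (B - A) = B \<bullet> B - A \<bullet> B"
      by (simp_all add: inner_diff_right inner_commute[of B A])
    ultimately have neg: "A \<bullet> (B - A) < 0" and pos: "0 < B \<bullet> (B - A)" by linarith+
    have "\<forall>\<^sub>F s in at_right 0. p + s *\<^sub>R (B - A) \<in> \<Omega>"
      using neg unfolding A_def by (rule eventually_in_domain[OF assms(1) *(1) assms(3)])
    moreover have "\<forall>\<^sub>F s in at_right 0. p + s *\<^sub>R (B - A) \<in> U"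
      using eventually_along_line[OF eventually_nhds_in_open[OF local_defining_function_smooth(1,2)[OF assms(2)]], of "B - A"]
      by (auto simp: eventually_at_filter elim: eventually_mono)
    moreover obtain d where "d > 0" "\<And>h. 0 < h \<Longrightarrow> h < d \<Longrightarrow> 0 < \<rho> (p + h *\<^sub>R (B - A))"
      using DERIV_pos_inc_right[OF local_defining_function_line_derivative[OF assms(2)] pos[unfolded B_def]]
        local_defining_function_boundary(2)[OF assms(1,2,3)] local_defining_function_smooth(2)[OF assms(2)]
      by (auto simp: B_def)
    then have "\<forall>\<^sub>F s in at_right 0. 0 < \<rho> (p + s *\<^sub>R (B - A))"
      by (auto simp: eventually_at_right_field intro!: exI[of _ d])
    ultimately have "\<forall>\<^sub>F s in at_right (0::real). False"
      by eventually_elim (use assms(2) in \<open>force simp: local_defining_function_def\<close>)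
    then show False by simp
  qed
  then show ?thesis
    using \<open>A \<noteq> 0\<close> by (simp add: * A_def[symmetric] B_def[symmetric] sgn_div_norm inner_commute)
qed

lemma eventually_inward_normal_in_domain:
  assumes "open \<Omega>" "smooth_boundary \<Omega>" "p \<in> frontier \<Omega>"
  shows "\<forall>\<^sub>F s in at_right 0. p + s *\<^sub>R (- outward_normal \<Omega> p) \<in> \<Omega>"
proof -
  obtain U \<rho> where *: "local_defining_function \<Omega> p U \<rho>" using assms by (auto simp: smooth_boundary_def)
  show ?thesis
    using outward_normal_pos[OF assms(1) * assms(3)] by (intro eventually_in_domain[OF assms(1) * assms(3)]) simp
qed

text \<open>\<open>neumann_condition\<close> speaks of the extension of the interior gradient, while
  an argument at a minimum sees only values of \<open>g\<close>. L'Hopital's rule along the inward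
  normal, which enters \<Omega> at once, connects the two without a derivative of \<open>g\<close>
  at \<open>p\<close> itself.\<close>

lemma neumann_condition_difference_quotient:
  assumes \<Omega>: "open \<Omega>" "smooth_boundary \<Omega>" "p \<in> frontier \<Omega>"
    and g: "neumann_condition \<Omega> g" "continuous_on (closure \<Omega>) g" "\<And>x. x \<in> \<Omega> \<Longrightarrow> g differentiable (at x)"
  shows "((\<lambda>s. (g (p + s *\<^sub>R (- outward_normal \<Omega> p)) - g p) / s) \<longlongrightarrow> 0) (at_right 0)"
proof -
  define v where "v = - outward_normal \<Omega> p"
  obtain G where G: "continuous_on (closure \<Omega>) G" "\<And>x. x \<in> \<Omega> \<Longrightarrow> G x = grad g x" "G p \<bullet> v = 0"
    using g(1) \<Omega>(3) by (auto simp: neumann_condition_def v_def)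
  have ev: "\<forall>\<^sub>F s in at_right 0. p + s *\<^sub>R v \<in> \<Omega>"
    unfolding v_def by (rule eventually_inward_normal_in_domain[OF \<Omega>])
  then have ev': "\<forall>\<^sub>F s in at_right 0. p + s *\<^sub>R v \<in> closure \<Omega>"
    by eventually_elim (use closure_subset in auto)
  have p: "p \<in> closure \<Omega>" using \<Omega>(3) by (simp add: frontier_def)
  have line: "((\<lambda>s. p + s *\<^sub>R v) \<longlongrightarrow> p) (at_right 0)"
    by (auto intro!: tendsto_eq_intros)
  show ?thesis
    unfolding v_def[symmetric]
  proof (rule lhopital_right_0[where f' = "\<lambda>s. G (p + s *\<^sub>R v) \<bullet> v" and g' = "\<lambda>_. 1"])
    show "((\<lambda>s. g (p + s *\<^sub>R v) - g p) \<longlongrightarrow> 0) (at_right 0)"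
      using continuous_on_tendsto_compose[OF g(2) line p ev'] by (simp add: LIM_zero)
    show "((\<lambda>s. G (p + s *\<^sub>R v) \<bullet> v / 1) \<longlongrightarrow> 0) (at_right 0)"
      using tendsto_inner[OF continuous_on_tendsto_compose[OF G(1) line p ev'] tendsto_const[of v]] G(3) by simp
    show "\<forall>\<^sub>F s in at_right 0. ((\<lambda>s. g (p + s *\<^sub>R v) - g p) has_real_derivative G (p + s *\<^sub>R v) \<bullet> v) (at s)"
      using ev
    proof eventually_elim
      case (elim s)
      show ?case
        using DERIV_diff[OF has_real_derivative_along_line[OF g(3)[OF elim]] DERIV_const[of "g p"]]
        by (simp add: frechet_derivative_eq_grad[OF g(3)[OF elim]] G(2)[OF elim])
    qed
  qed (auto intro!: derivative_eq_intros simp: eventually_at_filter)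
qed

section \<open>Boundary barriers and their one-sided second derivatives\<close>

text \<open>An upper bound for the second derivative in the sense of support functions, which
  tolerates the kinks of a positive part. It suffices at a minimum of
  \<open>w + \<epsilon> * h\<close>, since replacing \<open>h\<close> by a larger function that
  touches it at \<open>x\<close> keeps the minimum.\<close>

definition touched_above :: "('a::euclidean_space \<Rightarrow> real) \<Rightarrow> 'a \<Rightarrow> 'a \<Rightarrow> real \<Rightarrow> bool" where
  "touched_above h x b M \<longleftrightarrow> (\<exists>k k' D. k 0 = h x \<and> (\<forall>\<^sub>F s in nhds 0. h (x + s *\<^sub>R b) \<le> k s) \<and>
     (\<forall>\<^sub>F s in nhds 0. (k has_real_derivative k' s) (at s)) \<and> (k' has_real_derivative D) (at 0) \<and> D \<le> M)"

lemma touched_above_add: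
  assumes "touched_above h1 x b M1" "touched_above h2 x b M2"
  shows "touched_above (\<lambda>y. h1 y + h2 y) x b (M1 + M2)"
proof -
  obtain k1 k1' D1 where 1: "k1 0 = h1 x" "\<forall>\<^sub>F s in nhds 0. h1 (x + s *\<^sub>R b) \<le> k1 s"
     "\<forall>\<^sub>F s in nhds 0. (k1 has_real_derivative k1' s) (at s)" "(k1' has_real_derivative D1) (at 0)" "D1 \<le> M1"
    using assms(1) unfolding touched_above_def by blast
  obtain k2 k2' D2 where 2: "k2 0 = h2 x" "\<forall>\<^sub>F s in nhds 0. h2 (x + s *\<^sub>R b) \<le> k2 s"
     "\<forall>\<^sub>F s in nhds 0. (k2 has_real_derivative k2' s) (at s)" "(k2' has_real_derivative D2) (at 0)" "D2 \<le> M2"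
    using assms(2) unfolding touched_above_def by blast
  have "\<forall>\<^sub>F s in nhds 0. h1 (x + s *\<^sub>R b) + h2 (x + s *\<^sub>R b) \<le> k1 s + k2 s"
    using 1(2) 2(2) by eventually_elim auto
  moreover have "\<forall>\<^sub>F s in nhds 0. ((\<lambda>s. k1 s + k2 s) has_real_derivative k1' s + k2' s) (at s)"
    using 1(3) 2(3) by eventually_elim (rule DERIV_add)
  ultimately show ?thesis
    unfolding touched_above_def using 1 2 DERIV_add[OF 1(4) 2(4)]
    by (intro exI[of _ "\<lambda>s. k1 s + k2 s"] exI[of _ "\<lambda>s. k1' s + k2' s"] exI[of _ "D1 + D2"]) auto
qed

lemma touched_above_sum:
  assumes "finite I" "\<And>i. i \<in> I \<Longrightarrow> touched_above (h i) x b (M i)"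
  shows "touched_above (\<lambda>y. \<Sum>i\<in>I. h i y) x b (\<Sum>i\<in>I. M i)"
  using assms
proof (induction I)
  case empty
  show ?case by (auto simp: touched_above_def intro!: exI[of _ "\<lambda>_. 0"] exI[of _ 0])
qed (auto intro: touched_above_add)

lemma finite_family_bounded_on_compact:
  fixes F :: "('b::topological_space \<Rightarrow> real) set"
  assumes "compact K" "finite F" "\<And>k. k \<in> F \<Longrightarrow> continuous_on K k"
  obtains B where "\<And>k x. k \<in> F \<Longrightarrow> x \<in> K \<Longrightarrow> \<bar>k x\<bar> \<le> B"
proof -
  have "bounded (\<Union>k\<in>F. k ` K)"
    using assms by (intro bounded_Union) (auto intro!: compact_imp_bounded compact_continuous_image)
  then show ?thesis using that by (fastforce simp: bounded_iff)
qed

text \<open>Near \<open>p\<close> the barrier is \<open>(r\<^sup>2 - \<bar>x - p\<bar>\<^sup>2)\<^sup>+ \<rho>(x)\<close>. Since \<open>\<rho> < 0\<close> inside the domain, it is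
  touched from above by \<open>0\<close> where the cutoff vanishes, so no smooth cutoff is needed.\<close>

lemma local_neumann_barrier:
  fixes \<Omega> :: "'a::euclidean_space set"
  assumes "open \<Omega>" "smooth_boundary \<Omega>" and ldf: "local_defining_function \<Omega> p U \<rho>"
  obtains r h M where "0 < r" "continuous_on UNIV h"
    "\<And>x b. x \<in> \<Omega> \<Longrightarrow> b \<in> Basis \<Longrightarrow> touched_above h x b M"
    "\<And>p'. p' \<in> frontier \<Omega> \<Longrightarrow> \<exists>\<kappa>\<ge>0. (p' \<in> ball p r \<longrightarrow> 0 < \<kappa>) \<and>
       (\<forall>\<^sub>F s in at_right 0. h (p' + s *\<^sub>R (- outward_normal \<Omega> p')) \<le> h p' - \<kappa> * s)"
proof -
  note * = local_defining_function_smooth[OF ldf]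
  have \<Omega>U: "\<Omega> \<inter> U = {x \<in> U. \<rho> x < 0}" using ldf by (auto simp: local_defining_function_def)
  obtain r where r: "r > 0" "cball p r \<subseteq> U" using *(1,2) open_contains_cball by blast
  define q where "q x = r\<^sup>2 - (norm (x - p))\<^sup>2" for x
  define h where "h x = max 0 (q x) * \<rho> x" for x
  have q_pos: "0 < q x \<longleftrightarrow> x \<in> ball p r" for x
    using r(1) power_mono_iff[of r "norm (x - p)" 2]
    by (simp add: q_def dist_norm norm_minus_commute not_le[symmetric] del: power_mono_iff)
  \<comment> \<open>Nothing is known about \<rho> outside \<open>U\<close>, so continuity is glued
    from two open sets: the complement of the closed ball, where the cutoff makes \<open>h\<close>
    vanish, and \<open>U\<close>.\<close>
  have "continuous_on (- cball p r) h"
  proof (rule continuous_on_eq[OF continuous_on_const])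
    show "0 = h x" if "x \<in> - cball p r" for x using that q_pos[of x] by (simp add: h_def)
  qed
  moreover have "continuous_on U h"
    unfolding h_def q_def using *(3) by (intro continuous_intros)
  ultimately have "continuous_on (- cball p r \<union> U) h"
    using *(1) by (intro continuous_on_open_Un) auto
  moreover have "- cball p r \<union> U = UNIV" using r(2) by auto
  ultimately have h_cont: "continuous_on UNIV h" by simp
  have h_nonpos: "h x \<le> 0" if "x \<in> \<Omega>" for x
  proof (cases "x \<in> ball p r")
    case True
    then have "x \<in> U" using r(2) by auto
    then show ?thesis using \<Omega>U that by (force simp: h_def mult_le_0_iff)
  qed (use q_pos[of x] in \<open>simp add: h_def\<close>)
  define F where "F = {\<rho>} \<union> (\<lambda>b x. frechet_derivative \<rho> (at x) b) ` Basis
    \<union> (\<lambda>b x. frechet_derivative (\<lambda>y. frechet_derivative \<rho> (at y) b) (at x) b) ` Basis"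
  have "continuous_on U k" if "k \<in> F" for k
    using that *(3,5,6) unfolding F_def by auto
  then have "continuous_on (cball p r) k" if "k \<in> F" for k
    using that r(2) continuous_on_subset by blast
  then obtain B where B: "\<And>k x. k \<in> F \<Longrightarrow> x \<in> cball p r \<Longrightarrow> \<bar>k x\<bar> \<le> B"
    using finite_family_bounded_on_compact[of "cball p r" F] by (auto simp: F_def)
  have "0 \<le> B" using B[of \<rho> p] r(1) by (auto simp: F_def)
  \<comment> \<open>A bound for \<open>- 2 * \<rho> - 4 * c * \<rho>1 + q * \<rho>2\<close>, the
    second derivative of the product along a coordinate line; here
    \<open>\<bar>c\<bar> \<le> r\<close> and \<open>\<bar>q\<bar> \<le> r\<^sup>2\<close> on the
    ball.\<close>
  define M where "M = 2 * B + 4 * r * B + r\<^sup>2 * B"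
  have M: "0 \<le> M" using \<open>0 \<le> B\<close> r(1) by (simp add: M_def)
  have touched: "touched_above h x b M" if x: "x \<in> \<Omega>" and b: "b \<in> Basis" for x b
  proof (cases "x \<in> ball p r")
    case False
    then have "h x = 0" using q_pos[of x] by (simp add: h_def)
    moreover have "\<forall>\<^sub>F s in nhds 0. h (x + s *\<^sub>R b) \<le> 0"
      using eventually_along_line[OF eventually_nhds_in_open[OF \<open>open \<Omega>\<close> x], of b]
      by eventually_elim (rule h_nonpos)
    ultimately show ?thesis
      using M by (auto simp: touched_above_def intro!: exI[of _ "\<lambda>_. 0"] exI[of _ 0])
  next
    case True
    then have xU: "x \<in> U" "x \<in> cball p r" using r(2) by auto
    define c where "c = (x - p) \<bullet> b"
    define \<rho>1 where "\<rho>1 y = frechet_derivative \<rho> (at y) b" for y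
    define \<rho>2 where "\<rho>2 = frechet_derivative \<rho>1 (at x) b"
    have q_line: "q (x + s *\<^sub>R b) = q x - 2 * s * c - s\<^sup>2" for s
      using b unfolding q_def c_def power2_norm_eq_inner
      by (simp add: inner_simps inner_commute power2_eq_square algebra_simps)
    have dq: "((\<lambda>s. q x - 2 * s * c - s\<^sup>2) has_real_derivative - 2 * c - 2 * s) (at s)" for s
      by (auto intro!: derivative_eq_intros)
    have dq': "((\<lambda>s. - 2 * c - 2 * s) has_real_derivative - 2) (at s)" for s :: real
      by (auto intro!: derivative_eq_intros)
    have d\<rho>: "\<forall>\<^sub>F s in nhds 0. ((\<lambda>s. \<rho> (x + s *\<^sub>R b)) has_real_derivative \<rho>1 (x + s *\<^sub>R b)) (at s)"
      "((\<lambda>s. \<rho>1 (x + s *\<^sub>R b)) has_real_derivative \<rho>2) (at 0)"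
      using twice_diff_on_line_derivatives[OF *(4,1) xU(1) b] by (simp_all add: \<rho>1_def[abs_def] \<rho>2_def)
    then have d\<rho>0: "((\<lambda>s. \<rho> (x + s *\<^sub>R b)) has_real_derivative \<rho>1 x) (at 0)"
      using eventually_nhds_x_imp_x by fastforce
    define k where "k s = (q x - 2 * s * c - s\<^sup>2) * \<rho> (x + s *\<^sub>R b)" for s
    define k' where "k' s = (- 2 * c - 2 * s) * \<rho> (x + s *\<^sub>R b) + \<rho>1 (x + s *\<^sub>R b) * (q x - 2 * s * c - s\<^sup>2)" for s
    have "k 0 = h x" using True q_pos[of x] by (simp add: k_def h_def)
    moreover have "\<forall>\<^sub>F s in nhds 0. h (x + s *\<^sub>R b) \<le> k s"
      using eventually_along_line[OF eventually_nhds_in_open[OF open_ball True], of b]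
    proof eventually_elim
      case (elim s)
      then show ?case using q_pos[of "x + s *\<^sub>R b"] by (simp add: k_def h_def q_line)
    qed
    moreover have "\<forall>\<^sub>F s in nhds 0. (k has_real_derivative k' s) (at s)"
      using d\<rho>(1) by eventually_elim (unfold k_def k'_def, rule DERIV_mult[OF dq])
    moreover have "(k' has_real_derivative - 2 * \<rho> x + (- 2 * c) * \<rho>1 x + (\<rho>2 * q x + (- 2 * c) * \<rho>1 x)) (at 0)"
      unfolding k'_def
      using DERIV_add[OF DERIV_mult[OF dq'[of 0] d\<rho>0] DERIV_mult[OF d\<rho>(2) dq[of 0]]]
      by (simp add: algebra_simps)
    moreover have "- 2 * \<rho> x + (- 2 * c) * \<rho>1 x + (\<rho>2 * q x + (- 2 * c) * \<rho>1 x) \<le> M"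
    proof -
      have bounds: "\<bar>\<rho> x\<bar> \<le> B" "\<bar>\<rho>1 x\<bar> \<le> B" "\<bar>\<rho>2\<bar> \<le> B"
        using b B[of \<rho>, OF _ xU(2)] B[of "\<lambda>x. frechet_derivative \<rho> (at x) b", OF _ xU(2)]
          B[of "\<lambda>x. frechet_derivative (\<lambda>y. frechet_derivative \<rho> (at y) b) (at x) b", OF _ xU(2)]
        by (auto simp: F_def \<rho>1_def[abs_def] \<rho>2_def)
      have "\<bar>c\<bar> \<le> norm (x - p)" unfolding c_def using b by (rule Basis_le_norm)
      also have "\<dots> \<le> r" using xU(2) by (simp add: dist_norm norm_minus_commute)
      finally have "\<bar>c * \<rho>1 x\<bar> \<le> r * B"
        unfolding abs_mult using bounds \<open>0 \<le> B\<close> r(1) by (intro mult_mono) auto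
      moreover have "\<bar>q x\<bar> \<le> r\<^sup>2" using True q_pos[of x] by (simp add: q_def)
      then have "\<bar>q x * \<rho>2\<bar> \<le> r\<^sup>2 * B"
        unfolding abs_mult using bounds \<open>0 \<le> B\<close> by (intro mult_mono) auto
      ultimately show ?thesis using bounds(1) unfolding M_def by (simp add: algebra_simps abs_le_iff)
    qed
    ultimately show ?thesis unfolding touched_above_def by blast
  qed
  have descent: "\<exists>\<kappa>\<ge>0. (p' \<in> ball p r \<longrightarrow> 0 < \<kappa>) \<and>
       (\<forall>\<^sub>F s in at_right 0. h (p' + s *\<^sub>R (- outward_normal \<Omega> p')) \<le> h p' - \<kappa> * s)"
    if p': "p' \<in> frontier \<Omega>" for p'
  proof (cases "p' \<in> ball p r")
    case False
    then have "h p' = 0" using q_pos[of p'] by (simp add: h_def)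
    have "\<forall>\<^sub>F s in at_right 0. h (p' + s *\<^sub>R (- outward_normal \<Omega> p')) \<le> 0"
      using eventually_inward_normal_in_domain[OF assms(1,2) p']
      by eventually_elim (rule h_nonpos)
    then show ?thesis using False \<open>h p' = 0\<close> by (intro exI[of _ 0]) simp
  next
    case True
    define v where "v = - outward_normal \<Omega> p'"
    have "p' \<in> U" using True r(2) by auto
    note ldf' = local_defining_function_boundary[OF assms(1) ldf p' this]
    have neg: "grad \<rho> p' \<bullet> v < 0"
      using outward_normal_pos[OF assms(1) ldf'(1) p'] by (simp add: v_def)
    have "0 < q p'" using True q_pos by simp
    \<comment> \<open>As \<rho> vanishes at \<open>p'\<close>, the product has slope
      \<open>q p' * (grad \<rho> p' \<bullet> v) = - 2 * \<kappa>\<close> along the inward normal.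
      Half of it is given away to obtain an inequality for small \<open>s\<close>.\<close>
    define \<kappa> where "\<kappa> = - (grad \<rho> p' \<bullet> v) * q p' / 2"
    have "0 < \<kappa>" using neg \<open>0 < q p'\<close> by (simp add: \<kappa>_def mult_neg_pos)
    have q_line: "q (p' + s *\<^sub>R v) = q p' - 2 * s * ((p' - p) \<bullet> v) - s\<^sup>2 * (v \<bullet> v)" for s
      unfolding q_def power2_norm_eq_inner
      by (simp add: inner_simps inner_commute power2_eq_square algebra_simps)
    have "((\<lambda>s. q (p' + s *\<^sub>R v)) has_real_derivative - 2 * ((p' - p) \<bullet> v)) (at 0)"
      unfolding q_line by (auto intro!: derivative_eq_intros)
    from DERIV_mult[OF this local_defining_function_line_derivative[OF ldf'(1), of v]]
    have "((\<lambda>s. q (p' + s *\<^sub>R v) * \<rho> (p' + s *\<^sub>R v)) has_real_derivative - 2 * \<kappa>) (at 0)"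
      by (simp add: ldf'(2) \<kappa>_def)
    from DERIV_add[OF this DERIV_cmult_Id[of \<kappa>]]
    have "((\<lambda>s. q (p' + s *\<^sub>R v) * \<rho> (p' + s *\<^sub>R v) + \<kappa> * s) has_real_derivative - \<kappa>) (at 0)"
      by simp
    from DERIV_neg_dec_right[OF this] \<open>0 < \<kappa>\<close>
    obtain d where "d > 0" "\<And>s. 0 < s \<Longrightarrow> s < d \<Longrightarrow> q (p' + s *\<^sub>R v) * \<rho> (p' + s *\<^sub>R v) + \<kappa> * s < 0"
      by (auto simp: ldf'(2))
    then have "\<forall>\<^sub>F s in at_right 0. q (p' + s *\<^sub>R v) * \<rho> (p' + s *\<^sub>R v) + \<kappa> * s < 0"
      by (auto simp: eventually_at_right_field intro!: exI[of _ d])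
    moreover have "\<forall>\<^sub>F s in at_right 0. p' + s *\<^sub>R v \<in> ball p r"
      using eventually_along_line[OF eventually_nhds_in_open[OF open_ball True], of v]
      by (auto simp: eventually_at_filter elim: eventually_mono)
    ultimately have "\<forall>\<^sub>F s in at_right 0. h (p' + s *\<^sub>R v) \<le> h p' - \<kappa> * s"
    proof eventually_elim
      case (elim s)
      then show ?case using q_pos[of "p' + s *\<^sub>R v"] by (simp add: h_def ldf'(2))
    qed
    then show ?thesis unfolding v_def using \<open>0 < \<kappa>\<close> by (intro exI[of _ \<kappa>]) simp
  qed
  show ?thesis using that[OF r(1) h_cont touched descent] by blast
qed

text \<open>The frontier is compact, so finitely many local barriers are added. Each of them was
  controlled on the whole frontier with \<open>\<kappa> \<ge> 0\<close>: no summand increases along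
  an inward normal, hence none spoils the strict descent of the one whose ball contains
  \<open>p\<close>.\<close>

lemma neumann_barrier:
  fixes \<Omega> :: "'a::euclidean_space set"
  assumes "open \<Omega>" "bounded \<Omega>" "smooth_boundary \<Omega>"
  obtains h M where "continuous_on UNIV h"
    "\<And>x b. x \<in> \<Omega> \<Longrightarrow> b \<in> Basis \<Longrightarrow> touched_above h x b M"
    "\<And>p. p \<in> frontier \<Omega> \<Longrightarrow> \<exists>\<kappa>>0. \<forall>\<^sub>F s in at_right 0. h (p + s *\<^sub>R (- outward_normal \<Omega> p)) \<le> h p - \<kappa> * s"
proof -
  define local_barrier where "local_barrier p z \<longleftrightarrow> (case z of (r, h, M) \<Rightarrow> 0 < r \<and> continuous_on UNIV h \<and>
    (\<forall>x\<in>\<Omega>. \<forall>b\<in>Basis. touched_above h x b M) \<and>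
    (\<forall>p'\<in>frontier \<Omega>. \<exists>\<kappa>\<ge>0. (p' \<in> ball p r \<longrightarrow> 0 < \<kappa>) \<and>
       (\<forall>\<^sub>F s in at_right 0. h (p' + s *\<^sub>R (- outward_normal \<Omega> p')) \<le> h p' - \<kappa> * s)))"
    for p :: 'a and z
  have "\<forall>p\<in>frontier \<Omega>. \<exists>z. local_barrier p z"
  proof
    fix p assume "p \<in> frontier \<Omega>"
    then obtain U \<rho> where ldf: "local_defining_function \<Omega> p U \<rho>"
      using assms(3) by (auto simp: smooth_boundary_def)
    obtain r h M where "0 < r" "continuous_on UNIV h"
      "\<And>x b. x \<in> \<Omega> \<Longrightarrow> b \<in> Basis \<Longrightarrow> touched_above h x b M"
      "\<And>p'. p' \<in> frontier \<Omega> \<Longrightarrow> \<exists>\<kappa>\<ge>0. (p' \<in> ball p r \<longrightarrow> 0 < \<kappa>) \<and>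
       (\<forall>\<^sub>F s in at_right 0. h (p' + s *\<^sub>R (- outward_normal \<Omega> p')) \<le> h p' - \<kappa> * s)"
      using local_neumann_barrier[OF assms(1,3) ldf] by blast
    then have "local_barrier p (r, h, M)" by (simp add: local_barrier_def)
    then show "\<exists>z. local_barrier p z" ..
  qed
  from bchoice[OF this] obtain z where z: "\<And>p. p \<in> frontier \<Omega> \<Longrightarrow> local_barrier p (z p)" by blast
  define r h M where "r p = fst (z p)" and "h p = fst (snd (z p))" and "M p = snd (snd (z p))" for p
  have lb: "local_barrier p (r p, h p, M p)" if "p \<in> frontier \<Omega>" for p
    using z[OF that] by (simp add: r_def h_def M_def)
  have comp: "compact (frontier \<Omega>)" by (simp add: assms(2) compact_frontier_bounded)
  have "p \<in> ball p (r p)" if "p \<in> frontier \<Omega>" for p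
    using lb[OF that] by (simp add: local_barrier_def)
  then have cov: "frontier \<Omega> \<subseteq> (\<Union>p\<in>frontier \<Omega>. ball p (r p))" by blast
  obtain I where I: "I \<subseteq> frontier \<Omega>" "finite I" "frontier \<Omega> \<subseteq> (\<Union>p\<in>I. ball p (r p))"
    by (rule compactE_image[OF comp _ cov]) auto
  show ?thesis
  proof
    show "continuous_on UNIV (\<lambda>x. \<Sum>i\<in>I. h i x)"
      using I(1) lb by (intro continuous_on_sum) (auto simp: local_barrier_def)
    show "touched_above (\<lambda>x. \<Sum>i\<in>I. h i x) x b (\<Sum>i\<in>I. M i)" if "x \<in> \<Omega>" "b \<in> Basis" for x b
      using I lb that by (intro touched_above_sum) (auto simp: local_barrier_def)
    fix p assume p: "p \<in> frontier \<Omega>"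
    define v where "v = - outward_normal \<Omega> p"
    have "\<forall>i\<in>I. \<exists>\<kappa>\<ge>0. (p \<in> ball i (r i) \<longrightarrow> 0 < \<kappa>) \<and> (\<forall>\<^sub>F s in at_right 0. h i (p + s *\<^sub>R v) \<le> h i p - \<kappa> * s)"
    proof
      fix i assume "i \<in> I"
      then have "local_barrier i (r i, h i, M i)" using I(1) lb by blast
      then show "\<exists>\<kappa>\<ge>0. (p \<in> ball i (r i) \<longrightarrow> 0 < \<kappa>) \<and> (\<forall>\<^sub>F s in at_right 0. h i (p + s *\<^sub>R v) \<le> h i p - \<kappa> * s)"
        unfolding local_barrier_def v_def prod.case using p by blast
    qed
    from bchoice[OF this] obtain \<kappa> where "\<forall>i\<in>I. 0 \<le> \<kappa> i \<and> (p \<in> ball i (r i) \<longrightarrow> 0 < \<kappa> i) \<and>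
      (\<forall>\<^sub>F s in at_right 0. h i (p + s *\<^sub>R v) \<le> h i p - \<kappa> i * s)"
      by (elim exE)
    then have \<kappa>: "\<And>i. i \<in> I \<Longrightarrow> 0 \<le> \<kappa> i" "\<And>i. i \<in> I \<Longrightarrow> p \<in> ball i (r i) \<Longrightarrow> 0 < \<kappa> i"
      "\<And>i. i \<in> I \<Longrightarrow> \<forall>\<^sub>F s in at_right 0. h i (p + s *\<^sub>R v) \<le> h i p - \<kappa> i * s"
      by blast+
    obtain j where "j \<in> I" "p \<in> ball j (r j)" using I(3) p by blast
    then have "0 < sum \<kappa> I" using \<kappa>(1,2) I(2) by (intro sum_pos2) auto
    moreover have "\<forall>\<^sub>F s in at_right 0. \<forall>i\<in>I. h i (p + s *\<^sub>R v) \<le> h i p - \<kappa> i * s"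
      using I(2) \<kappa>(3) by (simp add: eventually_ball_finite)
    then have "\<forall>\<^sub>F s in at_right 0. (\<Sum>i\<in>I. h i (p + s *\<^sub>R v)) \<le> (\<Sum>i\<in>I. h i p) - sum \<kappa> I * s"
    proof eventually_elim
      case (elim s)
      then have "(\<Sum>i\<in>I. h i (p + s *\<^sub>R v)) \<le> (\<Sum>i\<in>I. h i p - \<kappa> i * s)" by (intro sum_mono) auto
      then show ?case by (simp add: sum_subtractf sum_distrib_right)
    qed
    ultimately show "\<exists>\<kappa>>0. \<forall>\<^sub>F s in at_right 0.
        (\<Sum>i\<in>I. h i (p + s *\<^sub>R (- outward_normal \<Omega> p))) \<le> (\<Sum>i\<in>I. h i p) - \<kappa> * s"
      unfolding v_def by blast
  qed
qed

section \<open>Minimum principle under the Neumann condition\<close>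

text \<open>Adding \<open>\<epsilon> * (h + H + L * t)\<close> excludes a negative minimum
  everywhere. On the frontier, \<open>h\<close> falls at a positive rate along the inward normal, so
  \<open>w\<close> would have to rise there, against its zero normal derivative. Inside, growth in
  time at rate \<open>L\<close> outweighs the at most \<open>DIM('a) * \<bar>M\<bar>\<close> due to
  the second derivatives of \<open>h\<close>, and the summand 1 in \<open>L\<close> gives
  strictness. \<open>H\<close> makes the added term nonnegative at time 0.\<close>

lemma neumann_supersolution_nonneg:
  fixes w :: "'a::euclidean_space \<Rightarrow> real \<Rightarrow> real"
  assumes \<Omega>: "open \<Omega>" "bounded \<Omega>" "smooth_boundary \<Omega>" and w: "heat_supersolution \<Omega> 0 T N S w"
    and cont: "continuous_on (closure \<Omega> \<times> {0..T}) (\<lambda>(x, t). w x t)"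
    and init: "\<And>x. x \<in> closure \<Omega> \<Longrightarrow> 0 \<le> w x 0"
    and neumann: "\<And>p t. p \<in> frontier \<Omega> \<Longrightarrow> t \<in> {0<..T} \<Longrightarrow>
      ((\<lambda>s. (w (p + s *\<^sub>R (- outward_normal \<Omega> p)) t - w p t) / s) \<longlongrightarrow> 0) (at_right 0)"
    and x1: "x1 \<in> \<Omega>" and t1: "t1 \<in> {0..T}"
  shows "0 \<le> w x1 t1"
proof -
  obtain h M where h_cont: "continuous_on UNIV h"
    and touched: "\<And>x b. x \<in> \<Omega> \<Longrightarrow> b \<in> Basis \<Longrightarrow> touched_above h x b M"
    and descent: "\<And>p. p \<in> frontier \<Omega> \<Longrightarrow> \<exists>\<kappa>>0. \<forall>\<^sub>F s in at_right 0.
        h (p + s *\<^sub>R (- outward_normal \<Omega> p)) \<le> h p - \<kappa> * s"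
    using neumann_barrier[OF \<Omega>] by blast
  have "compact (closure \<Omega>)" using \<Omega>(2) by simp
  then obtain H where "\<And>k x. k \<in> {h} \<Longrightarrow> x \<in> closure \<Omega> \<Longrightarrow> \<bar>k x\<bar> \<le> H"
    by (rule finite_family_bounded_on_compact[of "closure \<Omega>" "{h}"])
      (auto intro: continuous_on_subset[OF h_cont])
  then have H: "\<bar>h x\<bar> \<le> H" if "x \<in> closure \<Omega>" for x using that by simp
  define L where "L = real DIM('a) * \<bar>M\<bar> + 1"
  have "0 < L" by (simp add: L_def add_nonneg_pos)
  have perturbed: "0 \<le> w x1 t1 + \<epsilon> * (h x1 + H + L * t1)" if "\<epsilon> > 0" for \<epsilon>
  proof (rule parabolic_min_principle[where K = "closure \<Omega>" and N = N
        and W = "\<lambda>x t. w x t + \<epsilon> * (h x + H + L * t)"])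
    show "compact (closure \<Omega>)" by fact
    have "continuous_on (closure \<Omega> \<times> {0..T}) (\<lambda>z. h (fst z))"
      by (rule continuous_on_compose2[OF h_cont]) (auto intro: continuous_intros)
    with cont show "continuous_on (closure \<Omega> \<times> {0..T}) (\<lambda>(x, t). w x t + \<epsilon> * (h x + H + L * t))"
      unfolding case_prod_beta by (intro continuous_intros)
    show "countable N" using w by (simp add: heat_supersolution_def)
    show "0 \<le> w x 0 + \<epsilon> * (h x + H + L * 0)" if "x \<in> closure \<Omega>" for x
      using init[OF that] H[OF that] \<open>\<epsilon> > 0\<close> by simp
    fix x t assume x: "x \<in> closure \<Omega>" and t: "0 < t" "t \<le> T" "t \<notin> N"
      and neg: "w x t + \<epsilon> * (h x + H + L * t) < 0"
      and xmin: "\<And>y. y \<in> closure \<Omega> \<Longrightarrow> w x t + \<epsilon> * (h x + H + L * t) \<le> w y t + \<epsilon> * (h y + H + L * t)"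
      and tmin: "\<And>s. s \<in> {0..t} \<Longrightarrow> w x t + \<epsilon> * (h x + H + L * t) \<le> w x s + \<epsilon> * (h x + H + L * s)"
    have xmin': "w x t + \<epsilon> * h x \<le> w y t + \<epsilon> * h y" if "y \<in> closure \<Omega>" for y
      using xmin[OF that] by (simp add: algebra_simps)
    show False
    proof (cases "x \<in> \<Omega>")
      case False
      then have p: "x \<in> frontier \<Omega>" using x \<Omega>(1) by (simp add: frontier_def interior_open)
      define v where "v = - outward_normal \<Omega> x"
      obtain \<kappa> where \<kappa>: "\<kappa> > 0" "\<forall>\<^sub>F s in at_right 0. h (x + s *\<^sub>R v) \<le> h x - \<kappa> * s"
        using descent[OF p] unfolding v_def by blast
      have "\<forall>\<^sub>F s in at_right (0::real). 0 < s" by (simp add: eventually_at_filter)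
      with \<kappa>(2) eventually_inward_normal_in_domain[OF \<Omega>(1,3) p, folded v_def]
      have "\<forall>\<^sub>F s in at_right 0. \<epsilon> * \<kappa> \<le> (w (x + s *\<^sub>R v) t - w x t) / s"
      proof eventually_elim
        case (elim s)
        have "\<epsilon> * h (x + s *\<^sub>R v) \<le> \<epsilon> * (h x - \<kappa> * s)" using elim \<open>\<epsilon> > 0\<close> by (intro mult_left_mono) auto
        moreover have "w x t + \<epsilon> * h x \<le> w (x + s *\<^sub>R v) t + \<epsilon> * h (x + s *\<^sub>R v)"
          using elim closure_subset by (intro xmin') auto
        ultimately show ?case using elim by (simp add: pos_le_divide_eq algebra_simps)
      qed
      then have "\<epsilon> * \<kappa> \<le> 0"
        using tendsto_lowerbound[OF neumann[OF p, of t, folded v_def]] t by simp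
      then show False using \<open>\<epsilon> > 0\<close> \<open>\<kappa> > 0\<close> by (simp add: mult_le_0_iff)
    next
      case True
      have "- (\<epsilon> * \<bar>M\<bar>) \<le> frechet_derivative (\<lambda>y. frechet_derivative (\<lambda>y. w y t) (at y) b) (at x) b"
        if b: "b \<in> Basis" for b
      proof -
        obtain k k' D where k: "k 0 = h x" "\<forall>\<^sub>F s in nhds 0. h (x + s *\<^sub>R b) \<le> k s"
          "\<forall>\<^sub>F s in nhds 0. (k has_real_derivative k' s) (at s)" "(k' has_real_derivative D) (at 0)" "D \<le> M"
          using touched[OF True b] unfolding touched_above_def by blast
        have "- (\<epsilon> * D) \<le> frechet_derivative (\<lambda>y. frechet_derivative (\<lambda>y. w y t) (at y) b) (at x) b"
        proof (rule second_derivative_at_min[OF _ \<Omega>(1) True b, where g = "\<lambda>s. \<epsilon> * k s" and g' = "\<lambda>s. \<epsilon> * k' s"])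
          show "twice_diff_on \<Omega> (\<lambda>y. w y t)" using w t by (auto simp: heat_supersolution_def)
          show "\<forall>\<^sub>F s in nhds 0. w x t + \<epsilon> * k 0 \<le> w (x + s *\<^sub>R b) t + \<epsilon> * k s"
            using k(2) eventually_along_line[OF eventually_nhds_in_open[OF \<Omega>(1) True], of b]
          proof eventually_elim
            case (elim s)
            have "w x t + \<epsilon> * h x \<le> w (x + s *\<^sub>R b) t + \<epsilon> * h (x + s *\<^sub>R b)"
              using elim closure_subset by (intro xmin') auto
            moreover have "\<epsilon> * h (x + s *\<^sub>R b) \<le> \<epsilon> * k s" using elim \<open>\<epsilon> > 0\<close> by simp
            ultimately show ?case using k(1) by simp
          qed
          show "\<forall>\<^sub>F s in nhds 0. ((\<lambda>s. \<epsilon> * k s) has_real_derivative \<epsilon> * k' s) (at s)"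
            using k(3) by eventually_elim (rule DERIV_cmult)
          show "((\<lambda>s. \<epsilon> * k' s) has_real_derivative \<epsilon> * D) (at 0)"
            using k(4) by (rule DERIV_cmult)
        qed
        moreover have "\<epsilon> * D \<le> \<epsilon> * \<bar>M\<bar>" using k(5) \<open>\<epsilon> > 0\<close> by (intro mult_left_mono) auto
        ultimately show ?thesis by linarith
      qed
      then have "(\<Sum>b\<in>(Basis::'a set). - (\<epsilon> * \<bar>M\<bar>)) \<le> laplacian (\<lambda>y. w y t) x"
        unfolding laplacian_def by (rule sum_mono)
      moreover have "(\<Sum>b\<in>(Basis::'a set). - (\<epsilon> * \<bar>M\<bar>)) = \<epsilon> - \<epsilon> * L"
        by (simp add: L_def algebra_simps)
      ultimately have "\<epsilon> - \<epsilon> * L \<le> laplacian (\<lambda>y. w y t) x" by linarith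
      moreover have wd: "((\<lambda>s. w x s) has_real_derivative laplacian (\<lambda>y. w y t) x + S x t) (at t)" "0 \<le> S x t"
        using w t True by (auto simp: heat_supersolution_def)
      have "((\<lambda>s. w x s + \<epsilon> * (h x + H + L * s)) has_real_derivative
          laplacian (\<lambda>y. w y t) x + S x t + \<epsilon> * L) (at t)"
        by (rule DERIV_add[OF wd(1)]) (auto intro!: derivative_eq_intros)
      from derivative_nonpos_at_left_min[OF this tmin t(1)]
      have "laplacian (\<lambda>y. w y t) x + S x t + \<epsilon> * L \<le> 0" by simp
      ultimately show False using wd(2) \<open>\<epsilon> > 0\<close> by linarith
    qed
  next
    show "x1 \<in> closure \<Omega>" using x1 closure_subset by blast
  qed (use t1 in auto)
  show ?thesis
  proof (rule field_le_epsilon)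
    fix e :: real assume "e > 0"
    define C where "C = h x1 + H + L * t1"
    have "0 \<le> C" using H[of x1] x1 closure_subset[of \<Omega>] \<open>0 < L\<close> t1 by (force simp: C_def)
    define \<epsilon> where "\<epsilon> = e / (C + 1)"
    have "\<epsilon> > 0" "\<epsilon> * C \<le> e" using \<open>0 \<le> C\<close> \<open>e > 0\<close> by (auto simp: \<epsilon>_def field_simps)
    then show "0 \<le> w x1 t1 + e" using perturbed[of \<epsilon>] by (simp add: C_def)
  qed
qed

subsection \<open>Lipschitz stability\<close>

lemma test_function_imp_continuous: "test_function \<Omega> f \<Longrightarrow> continuous_on UNIV f"
  unfolding test_function_def smooth_on_def by (metis Ck_on.simps(1))

text \<open>A monotone \<theta> is integrable on intervals and continuous off a countable set, so
  its indefinite integral is differentiable off that set. The increment bound is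
  \<open>\<theta> \<le> 1\<close>; the explicit values at both ends serve to evaluate differences of
  translates of \<Phi>.\<close>

lemma cutoff_primitive:
  fixes \<theta> :: "real \<Rightarrow> real"
  assumes "antimono \<theta>" and one: "\<forall>t\<le>0. \<theta> t = 1" and zero: "\<forall>t\<ge>a. \<theta> t = 0"
    and "b < 0" "0 < a" "a \<le> e"
  obtains \<Phi> N where "countable N"
    "\<And>t. b < t \<Longrightarrow> t < e \<Longrightarrow> t \<notin> N \<Longrightarrow> (\<Phi> has_real_derivative \<theta> t) (at t)"
    "continuous_on {b..e} \<Phi>"
    "\<And>s t. b \<le> s \<Longrightarrow> s \<le> t \<Longrightarrow> t \<le> e \<Longrightarrow> \<Phi> t - \<Phi> s \<le> t - s"
    "\<And>t. b \<le> t \<Longrightarrow> t \<le> 0 \<Longrightarrow> \<Phi> t = t - b"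
    "\<And>t. a \<le> t \<Longrightarrow> t \<le> e \<Longrightarrow> \<Phi> t = \<Phi> a"
proof -
  have int: "\<theta> integrable_on {s..t}" for s t
    using integrable_neg[OF integrable_on_mono_on[of s t "\<lambda>x. - \<theta> x"]] \<open>antimono \<theta>\<close>
    by (auto simp: monotone_on_def)
  define \<Phi> where "\<Phi> t = integral {b..t} \<theta>" for t
  define N where "N = {t. \<not> isCont (\<lambda>x. - \<theta> x) t}"
  have diff: "\<Phi> t - \<Phi> s = integral {s..t} \<theta>" if "b \<le> s" "s \<le> t" for s t
    using Henstock_Kurzweil_Integration.integral_combine[OF that int] by (simp add: \<Phi>_def)
  show ?thesis
  proof
    show "countable N"
      unfolding N_def using \<open>antimono \<theta>\<close> by (intro mono_ctble_discont) (auto simp: monotone_on_def)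
    show "(\<Phi> has_real_derivative \<theta> t) (at t)" if t: "b < t" "t < e" "t \<notin> N" for t
    proof -
      have "isCont \<theta> t" using t(3) isCont_minus[of t "\<lambda>x. - \<theta> x"] by (simp add: N_def)
      then have "continuous (at t within {b..e} - {}) \<theta>" by (simp add: continuous_at_imp_continuous_within)
      from integral_has_vector_derivative_continuous_at[OF int _ _ this] t
      have "((\<lambda>u. integral {b..u} \<theta>) has_real_derivative \<theta> t) (at t within {b..e})"
        by (simp add: has_real_derivative_iff_has_vector_derivative)
      moreover have "at t within {b..e} = at t" using t by (intro at_within_interior) auto
      ultimately show ?thesis unfolding \<Phi>_def[abs_def] by simp
    qed
    show "continuous_on {b..e} \<Phi>"
      unfolding \<Phi>_def[abs_def] using int by (rule indefinite_integral_continuous_1)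
    have "\<theta> t \<le> 1" for t
      using one antimonoD[OF \<open>antimono \<theta>\<close>, of 0 t] by (cases "t \<le> 0") auto
    then have "integral {s..t} \<theta> \<le> integral {s..t} (\<lambda>_. 1)" for s t
      using int by (intro integral_le) auto
    then have "integral {s..t} \<theta> \<le> t - s" if "s \<le> t" for s t
      using that \<open>integral {s..t} \<theta> \<le> integral {s..t} (\<lambda>_. 1)\<close> by simp
    then show "\<Phi> t - \<Phi> s \<le> t - s" if "b \<le> s" "s \<le> t" "t \<le> e" for s t
      using diff[OF that(1,2)] that by fastforce
    show "\<Phi> t = t - b" if "b \<le> t" "t \<le> 0" for t
    proof -
      have "\<Phi> t = integral {b..t} (\<lambda>_. 1)"
        unfolding \<Phi>_def using one that by (intro integral_cong) auto
      then show ?thesis using that by simp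
    qed
    show "\<Phi> t = \<Phi> a" if "a \<le> t" "t \<le> e" for t
    proof -
      have "\<Phi> t - \<Phi> a = integral {a..t} \<theta>" using assms that by (intro diff) auto
      also have "\<dots> = integral {a..t} (\<lambda>_. 0)" using zero by (intro integral_cong) auto
      finally show ?thesis by simp
    qed
  qed
qed

text \<open>The initial condition is imposed in \<Omega> and reaches the closure by continuity; the
  minimum principle runs over the compact closure.\<close>

lemma heat_solution_initial:
  assumes "heat_solution \<Omega> \<theta> f t0 u" "x \<in> closure \<Omega>"
  shows "u x 0 = 0"
proof (rule continuous_constant_on_closure[OF _ _ assms(2)])
  have "continuous_on (closure \<Omega> \<times> {0..}) (\<lambda>(x, t). u x t)" using assms(1) by (simp add: heat_solution_def)
  from continuous_on_compose2[OF this, of "closure \<Omega>" "\<lambda>x. (x, 0)"]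
  show "continuous_on (closure \<Omega>) (\<lambda>x. u x 0)" by (force intro: continuous_intros)
qed (use assms(1) in \<open>simp add: heat_solution_def\<close>)

lemma heat_solution_neumann:
  assumes "heat_solution \<Omega> \<theta> f t0 u" "open \<Omega>" "smooth_boundary \<Omega>" "p \<in> frontier \<Omega>" "0 < t"
  shows "((\<lambda>s. (u (p + s *\<^sub>R (- outward_normal \<Omega> p)) t - u p t) / s) \<longlongrightarrow> 0) (at_right 0)"
proof (rule neumann_condition_difference_quotient[OF assms(2-4)])
  show "neumann_condition \<Omega> (\<lambda>x. u x t)" using assms by (simp add: heat_solution_def)
  have "continuous_on (closure \<Omega> \<times> {0..}) (\<lambda>(x, t). u x t)" using assms(1) by (simp add: heat_solution_def)
  from continuous_on_compose2[OF this, of "closure \<Omega>" "\<lambda>x. (x, t)"] assms(5)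
  show "continuous_on (closure \<Omega>) (\<lambda>x. u x t)" by (force intro: continuous_intros)
  have "twice_diff_on \<Omega> (\<lambda>x. u x t)"
    using assms by (auto simp: heat_solution_def intro: Ck_on_2_imp_twice_diff_on)
  then show "(\<lambda>x. u x t) differentiable (at x)" if "x \<in> \<Omega>" for x
    using that by (simp add: twice_diff_on_def)
qed

lemma heat_solution_equation:
  assumes "heat_solution \<Omega> \<theta> f t0 u"
  obtains N where "countable N" "\<And>t x. 0 < t \<Longrightarrow> t \<notin> N \<Longrightarrow> x \<in> \<Omega> \<Longrightarrow>
       ((\<lambda>s. u x s) has_real_derivative laplacian (\<lambda>y. u y t) x + \<theta> (t - t0) * f x) (at t)"
proof -
  have "\<exists>N. countable N \<and> (\<forall>t>0. t \<notin> N \<longrightarrow> (\<forall>x\<in>\<Omega>.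
       ((\<lambda>s. u x s) has_real_derivative laplacian (\<lambda>y. u y t) x + \<theta> (t - t0) * f x) (at t)))"
    using assms unfolding heat_solution_def by (elim conjE)
  then show ?thesis using that by (elim exE conjE) simp
qed

section \<open>Quantitative comparison of two solutions\<close>

text \<open>A later switch-off means a larger source, since \<open>t - t1 < t - t0\<close> and
  \<theta> is non-increasing. The free countable set \<open>N'\<close> leaves room for times at
  which the amplitude of a barrier is not differentiable.\<close>

lemma heat_solution_difference_supersolution:
  assumes "open \<Omega>" "antimono \<theta>" "\<forall>x\<in>closure \<Omega>. f x \<ge> 0" "t0 < t1"
    and u: "heat_solution \<Omega> \<theta> f t0 u" and v: "heat_solution \<Omega> \<theta> f t1 v"
  obtains N where "\<And>N'. countable N' \<Longrightarrow> heat_supersolution \<Omega> 0 T (N \<union> N')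
    (\<lambda>x t. (\<theta> (t - t1) - \<theta> (t - t0)) * f x) (\<lambda>x t. v x t - u x t)"
proof -
  obtain Nu where Nu: "countable Nu" "\<And>t x. 0 < t \<Longrightarrow> t \<notin> Nu \<Longrightarrow> x \<in> \<Omega> \<Longrightarrow>
       ((\<lambda>s. u x s) has_real_derivative laplacian (\<lambda>y. u y t) x + \<theta> (t - t0) * f x) (at t)"
    by (rule heat_solution_equation[OF u]) (rule that)
  obtain Nv where Nv: "countable Nv" "\<And>t x. 0 < t \<Longrightarrow> t \<notin> Nv \<Longrightarrow> x \<in> \<Omega> \<Longrightarrow>
       ((\<lambda>s. v x s) has_real_derivative laplacian (\<lambda>y. v y t) x + \<theta> (t - t1) * f x) (at t)"
    by (rule heat_solution_equation[OF v]) (rule that)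
  have tu: "twice_diff_on \<Omega> (\<lambda>x. u x t)" and tv: "twice_diff_on \<Omega> (\<lambda>x. v x t)" if "0 < t" for t
    using u v that by (auto simp: heat_solution_def intro: Ck_on_2_imp_twice_diff_on)
  have "continuous_on (\<Omega> \<times> {0..T}) (\<lambda>(x, t). u x t)" "continuous_on (\<Omega> \<times> {0..T}) (\<lambda>(x, t). v x t)"
    using u v closure_subset[of \<Omega>] unfolding heat_solution_def
    by (auto elim!: continuous_on_subset)
  then have cont: "continuous_on (\<Omega> \<times> {0..T}) (\<lambda>(x, t). v x t - u x t)"
    unfolding case_prod_beta by (intro continuous_on_diff)
  have source: "0 \<le> (\<theta> (t - t1) - \<theta> (t - t0)) * f x" if "x \<in> \<Omega>" for x t
    using that assms(3,4) closure_subset[of \<Omega>] antimonoD[OF assms(2), of "t - t1" "t - t0"]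
    by (intro mult_nonneg_nonneg) auto
  show ?thesis
  proof
    fix N' :: "real set" assume "countable N'"
    have "((\<lambda>s. v x s - u x s) has_real_derivative
        laplacian (\<lambda>y. v y t - u y t) x + (\<theta> (t - t1) - \<theta> (t - t0)) * f x) (at t)"
      if "0 < t" "t \<notin> Nu \<union> Nv" "x \<in> \<Omega>" for x t
    proof (rule DERIV_cong[OF DERIV_diff[OF Nv(2) Nu(2)]])
      show "laplacian (\<lambda>y. v y t) x + \<theta> (t - t1) * f x - (laplacian (\<lambda>y. u y t) x + \<theta> (t - t0) * f x)
          = laplacian (\<lambda>y. v y t - u y t) x + (\<theta> (t - t1) - \<theta> (t - t0)) * f x"
        using twice_diff_on_diff(2)[OF tv tu assms(1), of t t x] that by (simp add: algebra_simps)
    qed (use that in auto)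
    then show "heat_supersolution \<Omega> 0 T ((Nu \<union> Nv) \<union> N')
      (\<lambda>x t. (\<theta> (t - t1) - \<theta> (t - t0)) * f x) (\<lambda>x t. v x t - u x t)"
      unfolding heat_supersolution_def
      using cont source Nu(1) Nv(1) \<open>countable N'\<close> twice_diff_on_diff(1)[OF tv tu assms(1)] by auto
  qed
qed

text \<open>The barrier \<open>A(t) ((r\<^sup>2 - \<bar>x - y0\<bar>\<^sup>2)\<^sup>+)\<^sup>2\<close> is used with \<open>A\<close> the primitive of
  \<open>\<theta>(t - t1) - \<theta>(t - t0)\<close> damped by \<open>exp (- \<mu> t)\<close>. From time \<open>\<tau>\<close> on, this primitive
  equals \<open>t1 - t0\<close>.\<close>

lemma heat_solution_difference_initial_bump:
  fixes \<Omega> :: "'a::euclidean_space set"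
  assumes \<Omega>: "open \<Omega>" and f: "\<forall>x\<in>closure \<Omega>. f x \<ge> 0" and "antimono \<theta>" "0 < a"
    and one: "\<forall>t\<le>0. \<theta> t = 1" and zero: "\<forall>t\<ge>a. \<theta> t = 0" and T: "\<tau> < T"
    and ball: "cball y0 r \<subseteq> \<Omega>" "0 < r" "\<forall>x\<in>cball y0 r. \<delta> \<le> f x" "0 < \<delta>"
  obtains m where "0 < m"
    "\<And>t0 t1 u v x. 0 < t0 \<Longrightarrow> t0 < t1 \<Longrightarrow> t1 + a \<le> \<tau> \<Longrightarrow> heat_solution \<Omega> \<theta> f t0 u \<Longrightarrow>
      heat_solution \<Omega> \<theta> f t1 v \<Longrightarrow> (\<forall>x\<in>\<Omega>. \<forall>t\<in>{0..T}. 0 \<le> v x t - u x t) \<Longrightarrow>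
      x \<in> ball y0 (r / 2) \<Longrightarrow> m * (t1 - t0) \<le> v x \<tau> - u x \<tau>"
proof -
  \<comment> \<open>The discriminant condition with \<open>\<alpha> = 0\<close>: the ball does not
    grow here.\<close>
  define \<mu> where "\<mu> = (8 + 4 * real DIM('a))\<^sup>2 / (32 * r\<^sup>2)"
  have \<mu>: "0 \<le> \<mu>" "32 * \<mu> * r\<^sup>2 = (8 + 4 * real DIM('a))\<^sup>2" using \<open>0 < r\<close> by (auto simp: \<mu>_def)
  \<comment> \<open>Chosen so that
    \<open>\<kappa> * q\<^sup>2 \<le> \<kappa> * r^4 = \<delta> \<le> f\<close> where the barrier is
    positive; the barrier then consumes no more source than \<open>f\<close> provides.\<close>
  define \<kappa> where "\<kappa> = \<delta> / r^4"
  have "0 < \<kappa>" using ball by (simp add: \<kappa>_def)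
  have \<kappa>: "\<kappa> * (r\<^sup>2)\<^sup>2 = \<delta>" using \<open>0 < r\<close> by (simp add: \<kappa>_def power_mult[symmetric])
  \<comment> \<open>The barrier at time \<tau> and distance \<open>r / 2\<close> from the centre,
    per unit of \<open>t1 - t0\<close>.\<close>
  define m where "m = \<kappa> * exp (- \<mu> * \<tau>) * (r\<^sup>2 - (r / 2)\<^sup>2)\<^sup>2"
  have "(r / 2)\<^sup>2 < r\<^sup>2" using \<open>0 < r\<close> by (intro power_strict_mono) auto
  then have "0 < m" using \<open>0 < \<kappa>\<close> by (simp add: m_def)
  have "m * (t1 - t0) \<le> v x \<tau> - u x \<tau>"
    if t: "0 < t0" "t0 < t1" "t1 + a \<le> \<tau>" and u: "heat_solution \<Omega> \<theta> f t0 u" and v: "heat_solution \<Omega> \<theta> f t1 v"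
      and nonneg: "\<forall>x\<in>\<Omega>. \<forall>t\<in>{0..T}. 0 \<le> v x t - u x t" and x: "x \<in> ball y0 (r / 2)"
    for t0 t1 u v x
  proof -
    define g where "g s = \<theta> (s - t1) - \<theta> (s - t0)" for s
    \<comment> \<open>The interval starts at \<open>- t1\<close>, the smallest value of
      \<open>s - t1\<close> for \<open>s \<ge> 0\<close>, and ends at \<open>T > \<tau>\<close>, so
      that both translates of \<Phi> are differentiated at interior points.\<close>
    obtain \<Phi> N where \<Phi>: "countable N"
      "\<And>s. - t1 < s \<Longrightarrow> s < T \<Longrightarrow> s \<notin> N \<Longrightarrow> (\<Phi> has_real_derivative \<theta> s) (at s)"
      "continuous_on {- t1..T} \<Phi>"
      "\<And>s s'. - t1 \<le> s \<Longrightarrow> s \<le> s' \<Longrightarrow> s' \<le> T \<Longrightarrow> \<Phi> s' - \<Phi> s \<le> s' - s"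
      "\<And>s. - t1 \<le> s \<Longrightarrow> s \<le> 0 \<Longrightarrow> \<Phi> s = s - (- t1)"
      "\<And>s. a \<le> s \<Longrightarrow> s \<le> T \<Longrightarrow> \<Phi> s = \<Phi> a"
      by (rule cutoff_primitive[OF \<open>antimono \<theta>\<close> one zero, of "- t1" T]) (use t \<open>0 < a\<close> T in auto)
    \<comment> \<open>The constant makes \<open>G 0 = 0\<close>, because the two translates of
      \<Phi> differ by exactly \<open>t1 - t0\<close> at time 0. The increment bound for \<Phi>
      keeps \<open>G\<close> nonnegative.\<close>
    define G where "G s = \<Phi> (s - t1) - \<Phi> (s - t0) + (t1 - t0)" for s
    have G0: "G 0 = 0" using \<Phi>(5)[of "- t1"] \<Phi>(5)[of "- t0"] t by (simp add: G_def)
    have G\<tau>: "G \<tau> = t1 - t0" using \<Phi>(6)[of "\<tau> - t1"] \<Phi>(6)[of "\<tau> - t0"] t T by (simp add: G_def)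
    have G_nonneg: "0 \<le> G s" if "s \<in> {0..\<tau>}" for s
      using \<Phi>(4)[of "s - t1" "s - t0"] that t T by (simp add: G_def)
    have G_cont: "continuous_on {0..\<tau>} G"
      unfolding G_def[abs_def] using t T
      by (intro continuous_intros continuous_on_compose2[OF \<Phi>(3)]) auto
    define N' where "N' = (\<lambda>s. s + t1) ` N \<union> (\<lambda>s. s + t0) ` N"
    have G_deriv: "(G has_real_derivative g s) (at s)" if s: "s \<in> {0<..\<tau>}" "s \<notin> N'" for s
    proof -
      have "s - t1 \<notin> N" "s - t0 \<notin> N" using s(2) by (force simp: N'_def)+
      then have "(\<Phi> has_real_derivative \<theta> (s - t1)) (at (s - t1))" "(\<Phi> has_real_derivative \<theta> (s - t0)) (at (s - t0))"
        using s(1) t T by (auto intro: \<Phi>(2))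
      then have "((\<lambda>s. \<Phi> (s - t1)) has_real_derivative \<theta> (s - t1)) (at s)" "((\<lambda>s. \<Phi> (s - t0)) has_real_derivative \<theta> (s - t0)) (at s)"
        using DERIV_shift[of \<Phi> _ s "- t1"] DERIV_shift[of \<Phi> _ s "- t0"] by simp_all
      then show ?thesis
        unfolding G_def[abs_def] g_def using DERIV_add[OF DERIV_diff DERIV_const[of "t1 - t0"]] by fastforce
    qed
    obtain N'' where w: "\<And>N'. countable N' \<Longrightarrow> heat_supersolution \<Omega> 0 \<tau> (N'' \<union> N')
       (\<lambda>x t. g t * f x) (\<lambda>x t. v x t - u x t)"
      unfolding g_def using heat_solution_difference_supersolution[OF \<Omega> \<open>antimono \<theta>\<close> f t(2) u v] by blast
    have "countable N'" using \<Phi>(1) by (simp add: N'_def)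
    let ?A = "\<lambda>s. \<kappa> * exp (- \<mu> * s) * G s"
    \<comment> \<open>The zero terms are the instance \<open>\<alpha> = 0\<close>,
      \<open>s0 = 0\<close> of the moving radius.\<close>
    have "?A \<tau> * (max 0 (r\<^sup>2 + 0 * (\<tau> - 0) - (norm (x - y0))\<^sup>2))\<^sup>2 \<le> v x \<tau> - u x \<tau>"
    proof (rule barrier_below_supersolution[OF \<Omega> ball(1) w[OF \<open>countable N'\<close>], where \<mu> = \<mu>
          and A' = "\<lambda>s. - \<mu> * ?A s + \<kappa> * exp (- \<mu> * s) * g s"])
      show "0 \<le> v x s - u x s" if "x \<in> \<Omega>" "s \<in> {0..\<tau>}" for x s
        using nonneg that T by simp
      show "r\<^sup>2 + 0 * (\<tau> - 0) \<le> r\<^sup>2" by simp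
      show "continuous_on {0..\<tau>} ?A" by (intro continuous_intros G_cont)
      show "0 \<le> ?A s" if "s \<in> {0..\<tau>}" for s using G_nonneg[OF that] \<open>0 < \<kappa>\<close> by simp
      show "(?A has_real_derivative - \<mu> * ?A s + \<kappa> * exp (- \<mu> * s) * g s) (at s)"
        if "s \<in> {0<..\<tau>} - (N'' \<union> N')" for s
      proof -
        have "((\<lambda>s. \<kappa> * exp (- \<mu> * s)) has_real_derivative - \<mu> * (\<kappa> * exp (- \<mu> * s))) (at s)"
          by (auto intro!: derivative_eq_intros)
        from DERIV_mult[OF this G_deriv[of s]] that show ?thesis by (simp add: algebra_simps)
      qed
      show "(- \<mu> * ?A s + \<kappa> * exp (- \<mu> * s) * g s + \<mu> * ?A s) * (r\<^sup>2 + 0 * (s - 0) - (norm (y - y0))\<^sup>2)\<^sup>2 \<le> g s * f y"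
        if s: "s \<in> {0<..\<tau>} - (N'' \<union> N')" and y: "y \<in> \<Omega>" "0 < r\<^sup>2 + 0 * (s - 0) - (norm (y - y0))\<^sup>2" for y s
      proof -
        have "norm (y - y0) < r" using y(2) \<open>0 < r\<close> by (simp add: power2_less_imp_less)
        then have "\<delta> \<le> f y" by (intro ball(3)[rule_format]) (simp add: dist_norm norm_minus_commute)
        have "0 \<le> g s" using antimonoD[OF \<open>antimono \<theta>\<close>, of "s - t1" "s - t0"] t by (simp add: g_def)
        have "\<kappa> * exp (- \<mu> * s) * (r\<^sup>2 - (norm (y - y0))\<^sup>2)\<^sup>2 \<le> \<kappa> * 1 * (r\<^sup>2)\<^sup>2"
          using \<open>0 < \<kappa>\<close> \<mu>(1) s y(2) by (intro mult_mono power_mono) auto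
        also have "\<dots> \<le> f y" using \<kappa> \<open>\<delta> \<le> f y\<close> by simp
        finally have "g s * (\<kappa> * exp (- \<mu> * s) * (r\<^sup>2 - (norm (y - y0))\<^sup>2)\<^sup>2) \<le> g s * f y"
          using \<open>0 \<le> g s\<close> by (rule mult_left_mono)
        then show ?thesis by (simp add: mult_ac)
      qed
      show "(2 * 0 + 8 + 4 * real DIM('a))\<^sup>2 \<le> 32 * \<mu> * r\<^sup>2" using \<mu>(2) by simp
      show "?A 0 * (max 0 (r\<^sup>2 + 0 * (0 - 0) - (norm (y - y0))\<^sup>2))\<^sup>2 \<le> v y 0 - u y 0" if "y \<in> \<Omega>" for y
        using G0 nonneg that t T \<open>0 < a\<close> by simp
      show "x \<in> cball y0 r" using x \<open>0 < r\<close> by simp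
    qed (use t \<open>0 < a\<close> \<open>0 < r\<close> in auto)
    moreover have "(r\<^sup>2 - (r / 2)\<^sup>2)\<^sup>2 \<le> (max 0 (r\<^sup>2 + 0 * (\<tau> - 0) - (norm (x - y0))\<^sup>2))\<^sup>2"
    proof (rule power_mono)
      have "(norm (x - y0))\<^sup>2 \<le> (r / 2)\<^sup>2"
        using x by (intro power_mono) (auto simp: dist_norm norm_minus_commute)
      then show "r\<^sup>2 - (r / 2)\<^sup>2 \<le> max 0 (r\<^sup>2 + 0 * (\<tau> - 0) - (norm (x - y0))\<^sup>2)" by simp
    qed (use \<open>(r / 2)\<^sup>2 < r\<^sup>2\<close> in simp)
    then have "?A \<tau> * (r\<^sup>2 - (r / 2)\<^sup>2)\<^sup>2 \<le> ?A \<tau> * (max 0 (r\<^sup>2 + 0 * (\<tau> - 0) - (norm (x - y0))\<^sup>2))\<^sup>2"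
      using \<open>0 < \<kappa>\<close> G\<tau> t by (intro mult_left_mono) auto
    ultimately show ?thesis by (simp add: m_def G\<tau> mult_ac)
  qed
  with \<open>0 < m\<close> that show ?thesis by blast
qed

text \<open>The sources are off from time \<tau> on, and two constants multiply: \<open>m\<close>
  measures what the source has left near a point where \<open>f\<close> is positive,
  \<open>c\<close> what survives the passage to \<open>x0\<close> in the remaining time
  \<open>T - \<tau>\<close>. Both are fixed before \<open>t0\<close>, \<open>t1\<close>,
  \<open>u\<close> and \<open>v\<close>.\<close>

lemma heat_solution_lower_bound:
  fixes \<Omega> :: "'a::euclidean_space set"
  assumes \<Omega>: "open \<Omega>" "connected \<Omega>" "bounded \<Omega>" "smooth_boundary \<Omega>"
    and f: "test_function \<Omega> f" "\<forall>x\<in>closure \<Omega>. f x \<ge> 0" "\<exists>x\<in>closure \<Omega>. f x \<noteq> 0"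
    and x0: "x0 \<in> \<Omega>" and \<theta>: "0 < a" "antimono \<theta>" "\<forall>t\<le>0. \<theta> t = 1" "\<forall>t\<ge>a. \<theta> t = 0"
    and T: "\<tau> < T"
  shows "\<exists>c>0. \<forall>t0 t1 u v. 0 < t0 \<longrightarrow> t0 < t1 \<longrightarrow> t1 + a \<le> \<tau> \<longrightarrow> heat_solution \<Omega> \<theta> f t0 u \<longrightarrow>
     heat_solution \<Omega> \<theta> f t1 v \<longrightarrow> c * (t1 - t0) \<le> v x0 T - u x0 T"
proof -
  obtain y0 where "y0 \<in> closure \<Omega>" "f y0 \<noteq> 0" using f(3) by blast
  \<comment> \<open>A point where \<open>f\<close> does not vanish belongs to the support, hence to
    \<Omega> and not merely to its closure.\<close>
  have "closure {x. f x \<noteq> 0} \<subseteq> \<Omega>" using f(1) by (simp add: test_function_def)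
  moreover have "y0 \<in> closure {x. f x \<noteq> 0}" using \<open>f y0 \<noteq> 0\<close> closure_subset[of "{x. f x \<noteq> 0}"] by auto
  ultimately have "y0 \<in> \<Omega>" by blast
  moreover have "0 \<le> f y0" using f(2) \<open>y0 \<in> closure \<Omega>\<close> by blast
  ultimately have y0: "y0 \<in> \<Omega>" "0 < f y0" using \<open>f y0 \<noteq> 0\<close> by auto
  have "open {x. f y0 / 2 < f x}"
    using test_function_imp_continuous[OF f(1)] by (intro open_Collect_less continuous_on_const) auto
  then have "open (\<Omega> \<inter> {x. f y0 / 2 < f x})" "y0 \<in> \<Omega> \<inter> {x. f y0 / 2 < f x}"
    using \<Omega>(1) y0 by auto
  then obtain r where r: "0 < r" "cball y0 r \<subseteq> \<Omega> \<inter> {x. f y0 / 2 < f x}"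
    using open_contains_cball by blast
  then have r': "cball y0 r \<subseteq> \<Omega>" "\<forall>x\<in>cball y0 r. f y0 / 2 \<le> f x" "0 < f y0 / 2"
    using y0 by (auto simp: subset_iff intro: less_imp_le)
  obtain m where m: "0 < m"
    "\<And>t0 t1 u v x. 0 < t0 \<Longrightarrow> t0 < t1 \<Longrightarrow> t1 + a \<le> \<tau> \<Longrightarrow> heat_solution \<Omega> \<theta> f t0 u \<Longrightarrow>
      heat_solution \<Omega> \<theta> f t1 v \<Longrightarrow> (\<forall>x\<in>\<Omega>. \<forall>t\<in>{0..T}. 0 \<le> v x t - u x t) \<Longrightarrow>
      x \<in> ball y0 (r / 2) \<Longrightarrow> m * (t1 - t0) \<le> v x \<tau> - u x \<tau>"
    by (rule heat_solution_difference_initial_bump[OF \<Omega>(1) f(2) \<theta>(2,1,3,4) T r'(1) r(1) r'(2,3)]) (rule that)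
  obtain c where c: "0 < c" "\<And>N S w \<kappa>. heat_supersolution \<Omega> \<tau> T N S w \<Longrightarrow>
     (\<forall>x\<in>\<Omega>. \<forall>t\<in>{\<tau>..T}. 0 \<le> w x t) \<Longrightarrow> 0 \<le> \<kappa> \<Longrightarrow> (\<forall>x\<in>ball y0 (r / 2). \<kappa> \<le> w x \<tau>) \<Longrightarrow>
     c * \<kappa> \<le> w x0 T"
    using positivity_spreads[OF \<Omega>(1,2) y0(1) x0 _ T, of "r / 2"] r(1) by auto
  have "c * m * (t1 - t0) \<le> v x0 T - u x0 T"
    if t: "0 < t0" "t0 < t1" "t1 + a \<le> \<tau>" and u: "heat_solution \<Omega> \<theta> f t0 u" and v: "heat_solution \<Omega> \<theta> f t1 v"
    for t0 t1 u v
  proof -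
    obtain N where "\<And>N'. countable N' \<Longrightarrow> heat_supersolution \<Omega> 0 T (N \<union> N')
        (\<lambda>x t. (\<theta> (t - t1) - \<theta> (t - t0)) * f x) (\<lambda>x t. v x t - u x t)"
      by (rule heat_solution_difference_supersolution[OF \<Omega>(1) \<theta>(2) f(2) t(2) u v]) (rule that)
    \<comment> \<open>The amplitudes used for the sign and for the propagation are smooth in time,
      so no exceptional times are added.\<close>
    note w = this[OF countable_empty]
    have nonneg: "0 \<le> v x t - u x t" if "x \<in> \<Omega>" "t \<in> {0..T}" for x t
    proof (rule neumann_supersolution_nonneg[OF \<Omega>(1,3,4) w _ _ _ that])
      have "continuous_on (closure \<Omega> \<times> {0..T}) (\<lambda>(x, t). u x t)" "continuous_on (closure \<Omega> \<times> {0..T}) (\<lambda>(x, t). v x t)"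
        using u v unfolding heat_solution_def by (auto elim!: continuous_on_subset)
      then show "continuous_on (closure \<Omega> \<times> {0..T}) (\<lambda>(x, t). v x t - u x t)"
        unfolding case_prod_beta by (intro continuous_on_diff)
      show "0 \<le> v x 0 - u x 0" if "x \<in> closure \<Omega>" for x
        using heat_solution_initial[OF u that] heat_solution_initial[OF v that] by simp
      show "((\<lambda>s. (v (p + s *\<^sub>R - outward_normal \<Omega> p) t - u (p + s *\<^sub>R - outward_normal \<Omega> p) t - (v p t - u p t)) / s) \<longlongrightarrow> 0) (at_right 0)"
        if "p \<in> frontier \<Omega>" "t \<in> {0<..T}" for p t
        using tendsto_diff[OF heat_solution_neumann[OF v \<Omega>(1,4) that(1)] heat_solution_neumann[OF u \<Omega>(1,4) that(1)], of t t] that(2)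
        by (simp add: diff_divide_distrib[symmetric] algebra_simps)
    qed
    have "c * (m * (t1 - t0)) \<le> v x0 T - u x0 T"
    proof (rule c(2)[OF heat_supersolution_subinterval[OF w]])
      show "\<forall>x\<in>ball y0 (r / 2). m * (t1 - t0) \<le> v x \<tau> - u x \<tau>"
        using m(2)[OF t u v] nonneg by blast
    qed (use nonneg t \<theta>(1) m(1) in auto)
    then show ?thesis by (simp add: mult.assoc)
  qed
  with c(1) m(1) show ?thesis by (intro exI[of _ "c * m"]) simp
qed

theorem theorem1:
  fixes \<Omega> :: "'a::euclidean_space set"
    and f :: "'a \<Rightarrow> real"
    and \<theta> :: "real \<Rightarrow> real"
    and x\<^sub>0 :: 'a
    and a t_low t_up T :: real
  assumes "open \<Omega>" and "connected \<Omega>" and "bounded \<Omega>" and "smooth_boundary \<Omega>"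
    and "test_function \<Omega> f"
    and "\<forall>x\<in>closure \<Omega>. f x \<ge> 0" and "\<exists>x\<in>closure \<Omega>. f x \<noteq> 0"
    and "x\<^sub>0 \<in> \<Omega>"
    and "a > 0"
    and "locally_L2 \<theta>" and "antimono \<theta>"
    and "\<forall>t\<le>0. \<theta> t = 1" and "\<forall>t\<ge>a. \<theta> t = 0"
    and "t_low > 0" and "t_up > 0" and "T > 0"
    and "t_low < t_up" and "t_up < T - a"
  shows "\<exists>C>0. \<forall>t\<^sub>0\<in>{t_low<..<t_up}. \<forall>t\<^sub>1\<in>{t_low<..<t_up}. \<forall>u v.
           heat_solution \<Omega> \<theta> f t\<^sub>0 u \<longrightarrow> heat_solution \<Omega> \<theta> f t\<^sub>1 v \<longrightarrow>
           \<bar>t\<^sub>1 - t\<^sub>0\<bar> \<le> C * \<bar>u x\<^sub>0 T - v x\<^sub>0 T\<bar>"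
proof -
  have "t_up + a < T" using assms by simp
  \<comment> \<open>Here \<open>\<tau> = t_up + a\<close>: by this time the source is off for every
    admissible switching time.\<close>
  from heat_solution_lower_bound[OF assms(1-9,11-13) this]
  obtain c where "0 < c" and bound: "\<forall>t0 t1 u v. 0 < t0 \<longrightarrow> t0 < t1 \<longrightarrow> t1 + a \<le> t_up + a \<longrightarrow>
     heat_solution \<Omega> \<theta> f t0 u \<longrightarrow> heat_solution \<Omega> \<theta> f t1 v \<longrightarrow> c * (t1 - t0) \<le> v x\<^sub>0 T - u x\<^sub>0 T"
    by (elim exE conjE)
  have "\<bar>t1 - t0\<bar> \<le> 1 / c * \<bar>u x\<^sub>0 T - v x\<^sub>0 T\<bar>"
    if t: "t0 \<in> {t_low<..<t_up}" "t1 \<in> {t_low<..<t_up}"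
      and u: "heat_solution \<Omega> \<theta> f t0 u" and v: "heat_solution \<Omega> \<theta> f t1 v" for t0 t1 u v
  proof -
    have "c * \<bar>t1 - t0\<bar> \<le> \<bar>u x\<^sub>0 T - v x\<^sub>0 T\<bar>"
    \<comment> \<open>The lower bound assumes ordered switching times; exchanging the two solutions
      covers the other order.\<close>
    proof (cases t0 t1 rule: linorder_cases)
      case less
      then show ?thesis using bound[rule_format, OF _ less _ u v] t \<open>t_low > 0\<close> by auto
    next
      case greater
      then show ?thesis using bound[rule_format, OF _ greater _ v u] t \<open>t_low > 0\<close> by auto
    qed simp
    then show ?thesis using \<open>0 < c\<close> by (simp add: field_simps)
  qed
  with \<open>0 < c\<close> show ?thesis by (intro exI[of _ "1 / c"]) simp
qed

end
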